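(* Let $U:\mathbb{R}^3\to\mathbb{R}$ be a scalar potential, $E(x)=-\nabla_x U(x)$, let $B:\mathbb{R}^3\to\mathbb{R}^3$ be a magnetic field, $x^0,v^0\in\mathbb{R}^3$, $T>0$, and let $x(t)$, with $v(t)=\dot x(t)$, be the solution on $[0,T]$ of the charged-particle dynamics $\ddot x(t)=\dot x(t)\times B(x(t))+E(x(t))$, $x(0)=x^0$, $\dot x(0)=v^0$. Suppose that the nonlinear function $E:\mathbb{R}^3\to\mathbb{R}^3$ is sufficiently smooth. Then there exists a sufficiently small $\alpha$ with $0<\alpha\le 1$ such that, for every stepsize $h$ with $0<h\le\alpha$ (and $T/h$ an integer), the numerical solutions $(x^n,v^n,r^n)$ started from $(x^0,v^0,r^0)$, $r^0=\exp(U(x^0))$, satisfy, with $t_n=nh$ and for all $n=0,1,2,\dots,T/h-1$: (i) for the scheme S1-ESAV, $x^{n+1}-x(t_{n+1})=\mathcal{O}(h)$ and $v^{n+1}-v(t_{n+1})=\mathcal{O}(h)$; (ii) for the scheme S2-ESAV, $x^{n+1}-x(t_{n+1})=\mathcal{O}(h^2)$ and $v^{n+1}-v(t_{n+1})=\mathcal{O}(h^2)$. Here the constants symbolized by $\mathcal{O}$ can depend on $T$ but not on $n$ or $h$.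
   Context: Write $B(x)=(b_1(x),b_2(x),b_3(x))^\intercal$ and define the skew-symmetric matrix $$\tilde B(x)=\begin{pmatrix} 0 & b_3(x) & -b_2(x) \\ -b_3(x) & 0 & b_1(x) \\ b_2(x) & -b_1(x) & 0 \end{pmatrix},$$ so that $\tilde B(x)v=v\times B(x)$; $e^{\tau\tilde B(x)}$ denotes the matrix exponential. For $x\in\mathbb{R}^3$, $r\in\mathbb{R}$ define $F(x,r)=\frac{E(x)}{\exp(U(x))}\,r$. The scalar auxiliary variable is $r(t)=\exp(U(x(t)))$. Scheme S1-ESAV: given $(x^n,v^n,r^n)$ with $r^n>0$, set $w^n=e^{h\tilde B(x^n)}v^n$, $\hat x^{n+1/2}=x^n+\frac h2 w^n$, $\hat r^{n+1/2}=r^n-\frac h2\exp(U(\hat x^{n+1/2}))\,(w^n)^\intercal E(\hat x^{n+1/2})$, $F^n=F(\hat x^{n+1/2},\hat r^{n+1/2})$, and $$x^{n+1}=x^n+h w^n+\tfrac{h^2}{2}F^n,\quad v^{n+1}=w^n+hF^n,\quad \ln(r^{n+1})=\ln(r^n)-(x^{n+1}-x^n)^\intercal F^n .$$ Scheme S2-ESAV: given $(x^n,v^n,r^n)$ with $r^n>0$, set $w^n=e^{\frac h2\tilde B(x^n)}v^n$, $\hat x^{n+1/2}=x^n+\frac h2 w^n$, $\hat r^{n+1/2}=r^n-\frac h2\exp(U(\hat x^{n+1/2}))\,(w^n)^\intercal E(\hat x^{n+1/2})$, $F^n=F(\hat x^{n+1/2},\hat r^{n+1/2})$, and $$x^{n+1}=x^n+h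 w^n+\tfrac{h^2}{2}F^n,\quad v^{n+1}=e^{\frac h2\tilde B(x^{n+1})}\left[w^n+hF^n\right],\quad \ln(r^{n+1})=\ln(r^n)-(x^{n+1}-x^n)^\intercal F^n .$$ In both schemes $r^{n+1}$ is the positive number $\exp\left[\ln(r^n)-(x^{n+1}-x^n)^\intercal F^n\right]$.
   Formalization: The magnetic field B is additionally assumed to be of class C^2 (the same class as is taken for "sufficiently smooth" E); for arbitrary B, e.g. one vanishing exactly on the solution curve and constant elsewhere, the claimed error bounds fail. *)

theory Defs
  imports "HOL-Analysis.Analysis"
begin

section \<open>Functions of class \<open>C\<^sup>k\<close>\<close>

text \<open>
  \<open>Ck k f\<close>: all iterated directional derivatives of \<open>f\<close> of order at most \<open>k\<close> exist
  (as total derivatives at each stage) and are continuous on the whole space.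
\<close>

primrec Ck :: "nat \<Rightarrow> ('a::euclidean_space \<Rightarrow> 'b::real_normed_vector) \<Rightarrow> bool" where
  "Ck 0 f \<longleftrightarrow> continuous_on UNIV f"
| "Ck (Suc k) f \<longleftrightarrow> (\<forall>z. f differentiable (at z)) \<and>
     (\<forall>d. Ck k (\<lambda>z. frechet_derivative f (at z) d))"

section \<open>The matrix exponential\<close>

text \<open>
  The type of square matrices carries no algebra structure under the matrix product, so the
  library's \<open>exp\<close> is unavailable for it. The power series is taken with respect to
  \<open>**\<close>; lemma \<open>summable_mat_exp\<close> shows that it always converges.
\<close>

definition mat_exp :: "real^'n^'n \<Rightarrow> real^'n^'n" where
  "mat_exp A = (\<Sum>k. (1 / fact k) *\<^sub>R ((**) A ^^ k) (mat 1))"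

definition entry_sum :: "real^'n^'n \<Rightarrow> real" where
  "entry_sum A = (\<Sum>i\<in>UNIV. \<Sum>j\<in>UNIV. \<bar>A $ i $ j\<bar>)"

lemma entry_sum_mult: "entry_sum (A ** B) \<le> entry_sum A * entry_sum B"
proof -
  have row: "(\<Sum>j\<in>UNIV. \<bar>B $ k $ j\<bar>) \<le> entry_sum B" for k
    unfolding entry_sum_def
    by (rule member_le_sum[where f = "\<lambda>k. \<Sum>j\<in>UNIV. \<bar>B $ k $ j\<bar>"]) (auto intro: sum_nonneg)
  have "entry_sum (A ** B) \<le> (\<Sum>i\<in>UNIV. \<Sum>j\<in>UNIV. \<Sum>k\<in>UNIV. \<bar>A $ i $ k\<bar> * \<bar>B $ k $ j\<bar>)"
    unfolding entry_sum_def matrix_matrix_mult_def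
    by (auto intro!: sum_mono order_trans[OF sum_abs] simp: abs_mult)
  also have "\<dots> = (\<Sum>i\<in>UNIV. \<Sum>k\<in>UNIV. \<bar>A $ i $ k\<bar> * (\<Sum>j\<in>UNIV. \<bar>B $ k $ j\<bar>))"
    unfolding sum_distrib_left by (rule sum.cong[OF refl], rule sum.swap)
  also have "\<dots> \<le> (\<Sum>i\<in>UNIV. \<Sum>k\<in>UNIV. \<bar>A $ i $ k\<bar> * entry_sum B)"
    by (intro sum_mono mult_left_mono row) auto
  also have "\<dots> = entry_sum A * entry_sum B"
    unfolding entry_sum_def[of A] by (simp add: sum_distrib_right)
  finally show ?thesis .
qed

lemma norm_le_entry_sum: "norm A \<le> entry_sum A"
proof -
  have "norm A \<le> (\<Sum>i\<in>UNIV. norm (A $ i))"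
    unfolding norm_vec_def by (rule L2_set_le_sum) auto
  also have "\<dots> \<le> entry_sum A"
    unfolding entry_sum_def
    by (intro sum_mono) (simp add: norm_le_l1_cart)
  finally show ?thesis .
qed

lemma entry_sum_power:
  "entry_sum (((**) A ^^ k) (mat 1)) \<le> entry_sum A ^ k * entry_sum (mat 1 :: real^'n^'n)"
  for A :: "real^'n^'n"
proof (induction k)
  case (Suc k)
  have "entry_sum (((**) A ^^ Suc k) (mat 1)) \<le> entry_sum A * entry_sum (((**) A ^^ k) (mat 1))"
    by (simp add: entry_sum_mult)
  also have "\<dots> \<le> entry_sum A * (entry_sum A ^ k * entry_sum (mat 1 :: real^'n^'n))"
    by (rule mult_left_mono[OF Suc]) (auto simp: entry_sum_def intro!: sum_nonneg)
  finally show ?case by (simp add: mult.assoc)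
qed simp

lemma summable_mat_exp: "summable (\<lambda>k. (1 / fact k) *\<^sub>R ((**) A ^^ k) (mat 1))"
  for A :: "real^'n^'n"
proof (rule summable_comparison_test')
  show "summable (\<lambda>k. (entry_sum A ^ k /\<^sub>R fact k) * entry_sum (mat 1 :: real^'n^'n))"
    by (intro summable_mult2 summable_exp_generic)
  show "norm ((1 / fact k) *\<^sub>R ((**) A ^^ k) (mat 1))
      \<le> (entry_sum A ^ k /\<^sub>R fact k) * entry_sum (mat 1 :: real^'n^'n)" for k
    using order_trans[OF norm_le_entry_sum entry_sum_power[of k A]]
    by (simp add: field_simps)
qed

section \<open>The magnetic field matrix\<close>

definition B_tilde :: "(real^3 \<Rightarrow> real^3) \<Rightarrow> real^3 \<Rightarrow> real^3^3" where
  "B_tilde B x = vector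
     [vector [0, B x $ 3, - (B x $ 2)],
      vector [- (B x $ 3), 0, B x $ 1],
      vector [B x $ 2, - (B x $ 1), 0]]"

lemma B_tilde_mult: "B_tilde B x *v v = cross3 v (B x)"
  by (simp add: B_tilde_def cross3_def matrix_vector_mult_def vec_eq_iff forall_3 sum_3)

section \<open>The two schemes\<close>

definition F_esav :: "(real^3 \<Rightarrow> real) \<Rightarrow> (real^3 \<Rightarrow> real^3) \<Rightarrow> real^3 \<Rightarrow> real \<Rightarrow> real^3" where
  "F_esav U E x r = (r / exp (U x)) *\<^sub>R E x"

text \<open>
  The value \<open>F\<^sup>n\<close> common to both schemes, as a function of \<open>x\<^sup>n\<close>, \<open>w\<^sup>n\<close> and \<open>r\<^sup>n\<close>.
\<close>

definition F_step ::
  "(real^3 \<Rightarrow> real) \<Rightarrow> (real^3 \<Rightarrow> real^3) \<Rightarrow> real \<Rightarrow> real^3 \<Rightarrow> real^3 \<Rightarrow> real \<Rightarrow> real^3" where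
  "F_step U E h x w r =
     (let xh = x + (h / 2) *\<^sub>R w;
          rh = r - (h / 2) * exp (U xh) * (w \<bullet> E xh)
      in F_esav U E xh rh)"

type_synonym state = "(real^3) \<times> (real^3) \<times> real"

definition S1_step ::
  "(real^3 \<Rightarrow> real) \<Rightarrow> (real^3 \<Rightarrow> real^3) \<Rightarrow> (real^3 \<Rightarrow> real^3) \<Rightarrow> real \<Rightarrow> state \<Rightarrow> state" where
  "S1_step U E B h = (\<lambda>(x, v, r).
     let w = mat_exp (h *\<^sub>R B_tilde B x) *v v;
         F = F_step U E h x w r;
         x' = x + h *\<^sub>R w + (h\<^sup>2 / 2) *\<^sub>R F;
         v' = w + h *\<^sub>R F;
         r' = exp (ln r - (x' - x) \<bullet> F)
     in (x', v', r'))"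

definition S2_step ::
  "(real^3 \<Rightarrow> real) \<Rightarrow> (real^3 \<Rightarrow> real^3) \<Rightarrow> (real^3 \<Rightarrow> real^3) \<Rightarrow> real \<Rightarrow> state \<Rightarrow> state" where
  "S2_step U E B h = (\<lambda>(x, v, r).
     let w = mat_exp ((h / 2) *\<^sub>R B_tilde B x) *v v;
         F = F_step U E h x w r;
         x' = x + h *\<^sub>R w + (h\<^sup>2 / 2) *\<^sub>R F;
         v' = mat_exp ((h / 2) *\<^sub>R B_tilde B x') *v (w + h *\<^sub>R F);
         r' = exp (ln r - (x' - x) \<bullet> F)
     in (x', v', r'))"

definition S1_num ::
  "(real^3 \<Rightarrow> real) \<Rightarrow> (real^3 \<Rightarrow> real^3) \<Rightarrow> (real^3 \<Rightarrow> real^3) \<Rightarrow> real^3 \<Rightarrow> real^3 \<Rightarrow>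
    real \<Rightarrow> nat \<Rightarrow> state" where
  "S1_num U E B x0 v0 h n = (S1_step U E B h ^^ n) (x0, v0, exp (U x0))"

definition S2_num ::
  "(real^3 \<Rightarrow> real) \<Rightarrow> (real^3 \<Rightarrow> real^3) \<Rightarrow> (real^3 \<Rightarrow> real^3) \<Rightarrow> real^3 \<Rightarrow> real^3 \<Rightarrow>
    real \<Rightarrow> nat \<Rightarrow> state" where
  "S2_num U E B x0 v0 h n = (S2_step U E B h ^^ n) (x0, v0, exp (U x0))"

abbreviation pos :: "state \<Rightarrow> real^3" where "pos s \<equiv> fst s"

abbreviation vel :: "state \<Rightarrow> real^3" where "vel s \<equiv> fst (snd s)"

section \<open>The charged-particle dynamics\<close>

text \<open>
  The derivatives at the end points \<open>0\<close> and \<open>T\<close> are one-sided.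
\<close>

definition cpd_solution ::
  "(real^3 \<Rightarrow> real^3) \<Rightarrow> (real^3 \<Rightarrow> real^3) \<Rightarrow> real^3 \<Rightarrow> real^3 \<Rightarrow> real \<Rightarrow>
    (real \<Rightarrow> real^3) \<Rightarrow> (real \<Rightarrow> real^3) \<Rightarrow> bool" where
  "cpd_solution E B x0 v0 T x v \<longleftrightarrow>
     x 0 = x0 \<and> v 0 = v0 \<and>
     (\<forall>t\<in>{0..T}. (x has_vector_derivative v t) (at t within {0..T})) \<and>
     (\<forall>t\<in>{0..T}. (v has_vector_derivative cross3 (v t) (B (x t)) + E (x t)) (at t within {0..T}))"

end

theory Submission
  imports Defs
begin

text \<open>
  In the variables \<open>(x, v, \<rho>)\<close> with \<open>\<rho> = ln r\<close>, both schemes are one-step methods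
  \<open>z \<mapsto> z + h \<cdot> \<phi>(h, z)\<close> whose increment is Lipschitz on bounded sets uniformly in
  \<open>0 < h \<le> 1\<close>, and \<open>\<rho> = U(x)\<close> along the exact solution. By the discrete Gronwall argument it
  suffices to bound the local error along the solution by \<open>O(h\<^sup>2)\<close> and \<open>O(h\<^sup>3)\<close> respectively.

  The auxiliary variable enters only through
  \<open>F = (exp(\<rho> - U(xh)) - h/2 \<cdot> w \<bullet> E(xh)) \<cdot> E(xh)\<close> with \<open>xh = x + h/2 \<cdot> w\<close>, whose scalar
  factor is \<open>1 + O(h\<^sup>2)\<close>, so that \<open>F\<close> is the midpoint value of \<open>E\<close> up to \<open>O(h\<^sup>2)\<close>. For S2-ESAV
  the exact velocity increment is the trapezoidal rule for \<open>v \<times> B\<close> plus the midpoint rule for \<open>E\<close>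
  up to \<open>O(h\<^sup>3)\<close>, and rotating the exact end velocity backwards by half a step shows that the
  scheme realises this quadrature up to \<open>O(h\<^sup>3)\<close>.
\<close>

section \<open>Uniformly Lipschitz families\<close>

text \<open>One constant serves both as sup bound and as Lipschitz constant: products preserve the
  Lipschitz property only for bounded factors, and compositions need the inner values confined to a
  ball. Uniformity in \<open>p\<close> keeps the constants independent of the stepsize.\<close>

definition ulip :: "'p set \<Rightarrow> 'z::real_normed_vector set \<Rightarrow> ('p \<Rightarrow> 'z \<Rightarrow> 'b::real_normed_vector) \<Rightarrow> bool" where
  "ulip P S f \<longleftrightarrow> (\<exists>L. \<forall>p\<in>P. \<forall>z\<in>S. \<forall>z'\<in>S.
     norm (f p z) \<le> L \<and> norm (f p z - f p z') \<le> L * norm (z - z'))"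

lemma ulipI:
  assumes "\<And>p z. p \<in> P \<Longrightarrow> z \<in> S \<Longrightarrow> norm (f p z) \<le> M"
    and "\<And>p z z'. p \<in> P \<Longrightarrow> z \<in> S \<Longrightarrow> z' \<in> S \<Longrightarrow> norm (f p z - f p z') \<le> L * norm (z - z')"
  shows "ulip P S f"
  unfolding ulip_def
proof (intro exI ballI conjI)
  fix p z z' assume *: "p \<in> P" "z \<in> S" "z' \<in> S"
  show "norm (f p z) \<le> max M L" using assms(1)[of p z] * by simp
  show "norm (f p z - f p z') \<le> max M L * norm (z - z')"
    using assms(2)[OF *] by (rule order_trans) (simp add: mult_right_mono)
qed

lemma ulipE:
  assumes "ulip P S f"
  obtains L where "L > 0" "\<And>p z. p \<in> P \<Longrightarrow> z \<in> S \<Longrightarrow> norm (f p z) \<le> L"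
    "\<And>p z z'. p \<in> P \<Longrightarrow> z \<in> S \<Longrightarrow> z' \<in> S \<Longrightarrow> norm (f p z - f p z') \<le> L * norm (z - z')"
proof -
  obtain L where L: "\<forall>p\<in>P. \<forall>z\<in>S. \<forall>z'\<in>S.
     norm (f p z) \<le> L \<and> norm (f p z - f p z') \<le> L * norm (z - z')"
    using assms unfolding ulip_def by blast
  show thesis
  proof (rule that[of "max L 1"])
    fix p z z' assume *: "p \<in> P" "z \<in> S" "z' \<in> S"
    have "norm (f p z - f p z') \<le> L * norm (z - z')" using L * by blast
    then show "norm (f p z - f p z') \<le> max L 1 * norm (z - z')"
      by (rule order_trans) (simp add: mult_right_mono)
  next
    fix p z assume "p \<in> P" "z \<in> S"
    then have "norm (f p z) \<le> L" using L by blast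
    then show "norm (f p z) \<le> max L 1" by simp
  qed simp
qed

lemma ulip_param:
  assumes "bounded (c ` P)"
  shows "ulip P S (\<lambda>p z. c p)"
proof -
  obtain M where "\<And>p. p \<in> P \<Longrightarrow> norm (c p) \<le> M" using assms by (auto simp: bounded_iff)
  then show ?thesis by (intro ulipI[where L = 0 and M = M]) auto
qed

lemma ulip_const [simp]: "ulip P S (\<lambda>p z. c)"
  by (rule ulipI[where L = 0 and M = "norm c"]) auto

lemma ulip_id: "bounded S \<Longrightarrow> ulip P S (\<lambda>p z. z)"
  by (auto simp: bounded_iff intro: ulipI[where L = 1])

lemma ulip_add:
  assumes "ulip P S f" "ulip P S g"
  shows "ulip P S (\<lambda>p z. f p z + g p z)"
proof -
  obtain L where L: "\<And>p z. p \<in> P \<Longrightarrow> z \<in> S \<Longrightarrow> norm (f p z) \<le> L"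
    "\<And>p z z'. p \<in> P \<Longrightarrow> z \<in> S \<Longrightarrow> z' \<in> S \<Longrightarrow> norm (f p z - f p z') \<le> L * norm (z - z')"
    using ulipE[OF assms(1)] by metis
  obtain M where M: "\<And>p z. p \<in> P \<Longrightarrow> z \<in> S \<Longrightarrow> norm (g p z) \<le> M"
    "\<And>p z z'. p \<in> P \<Longrightarrow> z \<in> S \<Longrightarrow> z' \<in> S \<Longrightarrow> norm (g p z - g p z') \<le> M * norm (z - z')"
    using ulipE[OF assms(2)] by metis
  show ?thesis
  proof (rule ulipI)
    show "norm (f p z + g p z) \<le> L + M" if "p \<in> P" "z \<in> S" for p z
      using L(1)[OF that] M(1)[OF that] by norm
    show "norm (f p z + g p z - (f p z' + g p z')) \<le> (L + M) * norm (z - z')"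
      if "p \<in> P" "z \<in> S" "z' \<in> S" for p z z'
      using norm_triangle_le[OF add_mono[OF L(2)[OF that] M(2)[OF that]]]
      by (simp add: algebra_simps)
  qed
qed

text \<open>Product-rule splitting: one argument is changed at a time and the other is bounded by
  its sup. Scalar multiples, inner products and matrix-vector products are all instances.\<close>

lemma ulip_bilinear:
  assumes "bounded_bilinear bl" "ulip P S f" "ulip P S g"
  shows "ulip P S (\<lambda>p z. bl (f p z) (g p z))"
proof -
  interpret bounded_bilinear bl by fact
  obtain K where K: "K > 0" "\<And>a b. norm (bl a b) \<le> norm a * norm b * K"
    using pos_bounded by metis
  obtain L where L: "L > 0" "\<And>p z. p \<in> P \<Longrightarrow> z \<in> S \<Longrightarrow> norm (f p z) \<le> L"
    "\<And>p z z'. p \<in> P \<Longrightarrow> z \<in> S \<Longrightarrow> z' \<in> S \<Longrightarrow> norm (f p z - f p z') \<le> L * norm (z - z')"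
    using ulipE[OF assms(2)] by metis
  obtain M where M: "M > 0" "\<And>p z. p \<in> P \<Longrightarrow> z \<in> S \<Longrightarrow> norm (g p z) \<le> M"
    "\<And>p z z'. p \<in> P \<Longrightarrow> z \<in> S \<Longrightarrow> z' \<in> S \<Longrightarrow> norm (g p z - g p z') \<le> M * norm (z - z')"
    using ulipE[OF assms(3)] by metis
  show ?thesis
  proof (rule ulipI)
    fix p z z' assume *: "p \<in> P" "z \<in> S" "z' \<in> S"
    have "norm (bl (f p z - f p z') (g p z)) \<le> (L * norm (z - z')) * M * K"
      using K(1) L(1)
      by (intro order_trans[OF K(2)] mult_right_mono mult_mono L(3) M(2) *) auto
    moreover have "norm (bl (f p z') (g p z - g p z')) \<le> L * (M * norm (z - z')) * K"
      using K(1) L(1)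
      by (intro order_trans[OF K(2)] mult_right_mono mult_mono L(2) M(3) *) auto
    moreover have "bl (f p z) (g p z) - bl (f p z') (g p z')
        = bl (f p z - f p z') (g p z) + bl (f p z') (g p z - g p z')"
      by (simp add: diff_left diff_right)
    ultimately show "norm (bl (f p z) (g p z) - bl (f p z') (g p z'))
        \<le> (2 * L * M * K) * norm (z - z')"
      by (simp add: norm_triangle_le algebra_simps)
  next
    fix p z assume *: "p \<in> P" "z \<in> S"
    show "norm (bl (f p z) (g p z)) \<le> L * M * K"
      using K(1) L(1)
      by (intro order_trans[OF K(2)] mult_right_mono mult_mono L(2) M(2) *) auto
  qed
qed

text \<open>The sup bound \<open>L\<close> of \<open>f\<close> confines its values to
  \<open>cball 0 L\<close>, so the constants of \<open>g\<close> on that ball apply; hence the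
  control of \<open>g\<close> on every centred ball.\<close>

lemma ulip_compose:
  assumes "ulip P S f" "\<And>R. ulip P (cball 0 R) g"
  shows "ulip P S (\<lambda>p z. g p (f p z))"
proof -
  obtain L where L: "L > 0" "\<And>p z. p \<in> P \<Longrightarrow> z \<in> S \<Longrightarrow> norm (f p z) \<le> L"
    "\<And>p z z'. p \<in> P \<Longrightarrow> z \<in> S \<Longrightarrow> z' \<in> S \<Longrightarrow> norm (f p z - f p z') \<le> L * norm (z - z')"
    using ulipE[OF assms(1)] by metis
  obtain M where M: "M > 0" "\<And>p z. p \<in> P \<Longrightarrow> z \<in> cball 0 L \<Longrightarrow> norm (g p z) \<le> M"
    "\<And>p z z'. p \<in> P \<Longrightarrow> z \<in> cball 0 L \<Longrightarrow> z' \<in> cball 0 L \<Longrightarrow> norm (g p z - g p z') \<le> M * norm (z - z')"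
    using ulipE[OF assms(2)[of L]] by metis
  show ?thesis
  proof (rule ulipI)
    fix p z z' assume *: "p \<in> P" "z \<in> S" "z' \<in> S"
    have "norm (g p (f p z) - g p (f p z')) \<le> M * norm (f p z - f p z')"
      using L(2) * by (intro M(3)) auto
    also have "\<dots> \<le> M * (L * norm (z - z'))"
      using M(1) by (intro mult_left_mono L(3) *) auto
    finally show "norm (g p (f p z) - g p (f p z')) \<le> (M * L) * norm (z - z')"
      by (simp add: mult.assoc)
  next
    fix p z assume *: "p \<in> P" "z \<in> S"
    show "norm (g p (f p z)) \<le> M" using L(2) * by (intro M(2)) auto
  qed
qed

lemma ulip_linear_cball:
  assumes "bounded_linear g"
  shows "ulip P (cball 0 R) (\<lambda>p. g)"
proof -
  interpret bounded_linear g by fact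
  obtain K where K: "K > 0" "\<And>a. norm (g a) \<le> norm a * K" using pos_bounded by metis
  show ?thesis
  proof (rule ulipI)
    show "norm (g z - g z') \<le> K * norm (z - z')" for z z'
      using K(2)[of "z - z'"] by (simp add: diff mult.commute)
    show "norm (g z) \<le> R * K" if "z \<in> cball 0 R" for z
      using K(2)[of z] K(1) that by (meson mem_cball_0 mult_right_mono less_imp_le order_trans)
  qed
qed

lemma ulip_linear: "bounded_linear g \<Longrightarrow> ulip P S f \<Longrightarrow> ulip P S (\<lambda>p z. g (f p z))"
  by (rule ulip_compose[OF _ ulip_linear_cball])

lemma ulip_minus: "ulip P S f \<Longrightarrow> ulip P S (\<lambda>p z. - f p z)"
  by (rule ulip_linear[OF bounded_linear_minus[OF bounded_linear_ident]])

lemma ulip_diff: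
  assumes "ulip P S f" "ulip P S g"
  shows "ulip P S (\<lambda>p z. f p z - g p z)"
  using ulip_add[OF assms(1) ulip_minus[OF assms(2)]] by simp

lemma ulip_Pair:
  assumes "ulip P S f" "ulip P S g"
  shows "ulip P S (\<lambda>p z. (f p z, g p z))"
proof -
  have "ulip P S (\<lambda>p z. (f p z, 0) + (0, g p z))"
    by (intro ulip_add ulip_linear[OF _ assms(1)] ulip_linear[OF _ assms(2)]
        bounded_linear_Pair bounded_linear_ident bounded_linear_zero)
  then show ?thesis by simp
qed

lemmas ulip_scaleR = ulip_bilinear[OF bounded_bilinear_scaleR]
lemmas ulip_inner = ulip_bilinear[OF bounded_bilinear_inner]

lemma ulip_sum: "finite I \<Longrightarrow> (\<And>i. i \<in> I \<Longrightarrow> ulip P S (f i)) \<Longrightarrow> ulip P S (\<lambda>p z. \<Sum>i\<in>I. f i p z)"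
  by (induction I rule: finite_induct) (auto intro: ulip_add)

text \<open>Mean value inequality on the compact convex ball. Continuity of the directional
  derivatives bounds the sum of their norms over the basis there, and this sum dominates the
  operator norm of \<open>f' z\<close>.\<close>

lemma ulip_C1:
  fixes f :: "'a::euclidean_space \<Rightarrow> 'b::real_normed_vector"
  assumes der: "\<And>z. (f has_derivative f' z) (at z)"
    and cont: "\<And>d. continuous_on UNIV (\<lambda>z. f' z d)"
  shows "ulip P (cball 0 R) (\<lambda>p. f)"
proof -
  have "compact ((\<lambda>z. \<Sum>b\<in>Basis. norm (f' z b)) ` cball 0 R)"
    by (intro compact_continuous_image continuous_on_sum continuous_on_norm
        continuous_on_subset[OF cont] subset_UNIV compact_cball)
  then obtain M where M: "\<And>z. z \<in> cball 0 R \<Longrightarrow> norm (\<Sum>b\<in>Basis. norm (f' z b)) \<le> M"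
    using compact_imp_bounded by (fastforce simp: bounded_iff)
  have onorm: "onorm (f' z) \<le> M" if "z \<in> cball 0 R" for z
  proof (rule onorm_bound)
    show "0 \<le> M" using M[OF that] norm_ge_zero order_trans by blast
    fix d :: 'a
    interpret bounded_linear "f' z" using der by (rule has_derivative_bounded_linear)
    have "norm (f' z d) = norm (\<Sum>b\<in>Basis. (d \<bullet> b) *\<^sub>R f' z b)"
      by (subst euclidean_representation[symmetric, of d]) (simp add: sum scaleR)
    also have "\<dots> \<le> (\<Sum>b\<in>Basis. norm d * norm (f' z b))"
      by (intro sum_norm_le) (simp add: Basis_le_norm mult_right_mono)
    also have "\<dots> = (\<Sum>b\<in>Basis. norm (f' z b)) * norm d"
      by (simp add: sum_distrib_left mult.commute)
    also have "\<dots> \<le> M * norm d" using M[OF that] by (intro mult_right_mono) auto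
    finally show "norm (f' z d) \<le> M * norm d" .
  qed
  have "continuous_on (cball 0 R) f"
    using der has_derivative_continuous by (blast intro: continuous_at_imp_continuous_on)
  then have "bounded (f ` cball 0 R)"
    by (intro compact_imp_bounded compact_continuous_image) auto
  then obtain K where K: "\<And>z. z \<in> cball 0 R \<Longrightarrow> norm (f z) \<le> K"
    by (meson bounded_iff imageI)
  show ?thesis
    by (rule ulipI[OF K], assumption,
        rule differentiable_bound[OF convex_cball has_derivative_at_withinI[OF der] onorm])
qed

lemma Ck_mono: "Ck (Suc k) f \<Longrightarrow> Ck k f"
proof (induction k arbitrary: f)
  case 0
  then show ?case
    by (auto intro!: continuous_at_imp_continuous_on differentiable_imp_continuous_within)
qed simp

lemma Ck_derivative:
  assumes "Ck (Suc k) f"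
  shows "(f has_derivative frechet_derivative f (at z)) (at z)"
  using assms by (simp add: frechet_derivative_works)

lemma ulip_Ck: "Ck (Suc k) f \<Longrightarrow> ulip P (cball 0 R) (\<lambda>p. f)"
proof (induction k arbitrary: f)
  case 0
  then show ?case
    by (intro ulip_C1[OF Ck_derivative[of 0]]) simp_all
qed (use Ck_mono in blast)

lemma ulip_exp: "ulip P (cball 0 R) (\<lambda>p. exp :: real \<Rightarrow> real)"
proof (rule ulip_C1)
  show "(exp has_derivative (\<lambda>d. exp z * d)) (at z)" for z :: real
    using DERIV_exp[of z] by (simp add: has_field_derivative_def)
qed (intro continuous_intros)

section \<open>The matrix exponential near zero\<close>

lemma entry_sum_nonneg [simp]: "0 \<le> entry_sum A"
  unfolding entry_sum_def by (intro sum_nonneg) auto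

lemma entry_sum_add: "entry_sum (A + B) \<le> entry_sum A + entry_sum B"
  unfolding entry_sum_def sum.distrib[symmetric] by (intro sum_mono) auto

lemma entry_sum_le_norm: "entry_sum A \<le> real (CARD('n) * CARD('n)) * norm A" for A :: "real^'n^'n"
proof -
  have "\<bar>A $ i $ j\<bar> \<le> norm A" for i j
    using component_le_norm_cart[of "A $ i" j] Finite_Cartesian_Product.norm_nth_le[of A i] by linarith
  then have "entry_sum A \<le> (\<Sum>i\<in>(UNIV::'n set). \<Sum>j\<in>(UNIV::'n set). norm A)"
    unfolding entry_sum_def by (intro sum_mono)
  then show ?thesis by simp
qed

lemma mat_power_scaleR: "((**) (h *\<^sub>R A) ^^ k) (mat 1) = h ^ k *\<^sub>R ((**) A ^^ k) (mat 1)"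
  for A :: "real^'n^'n"
proof (induction k)
  case (Suc k)
  have "(h *\<^sub>R A) ** (c *\<^sub>R B) = (h * c) *\<^sub>R (A ** B)" for c and B :: "real^'n^'n"
    by (simp add: matrix_matrix_mult_def vec_eq_iff sum_distrib_left algebra_simps)
  then show ?case using Suc by simp
qed simp

lemma mat_exp_scaleR_sums:
  "(\<lambda>k. (h ^ k / fact k) *\<^sub>R ((**) A ^^ k) (mat 1)) sums mat_exp (h *\<^sub>R A)" for A :: "real^'n^'n"
  using summable_sums[OF summable_mat_exp[of "h *\<^sub>R A"]] unfolding mat_exp_def
  by (simp add: mat_power_scaleR)

lemma norm_sums_le_exp:
  fixes f :: "nat \<Rightarrow> 'a::banach"
  assumes "f sums s" "\<And>k. norm (f k) \<le> c * (M ^ k / fact k)"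
  shows "norm s \<le> c * exp M"
proof -
  have g: "(\<lambda>k. c * (M ^ k / fact k)) sums (c * exp M)"
    using sums_mult[OF exp_converges[of M], of c] by (simp add: divide_inverse mult.commute)
  show ?thesis
    using norm_suminf_le[OF assms(2) sums_summable[OF g]] sums_unique[OF assms(1)] sums_unique[OF g] by simp
qed

text \<open>For \<open>k \<ge> n\<close> one has \<open>h ^ k \<le> h ^ n\<close> because
  \<open>h \<le> 1\<close>, so the tail is \<open>h ^ n\<close> times a series dominated by that of
  \<open>exp (entry_sum A)\<close>. The factor \<open>entry_sum (mat 1)\<close> stems from the
  powers starting at the identity.\<close>

lemma mat_exp_tail:
  fixes A :: "real^'n^'n"
  assumes "0 < h" "h \<le> 1"
  shows "norm (mat_exp (h *\<^sub>R A) - (\<Sum>k<n. (h ^ k / fact k) *\<^sub>R ((**) A ^^ k) (mat 1)))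
    \<le> (h ^ n * entry_sum (mat 1 :: real^'n^'n)) * exp (entry_sum A)"
proof (rule norm_sums_le_exp)
  let ?a = "\<lambda>k. (h ^ k / fact k) *\<^sub>R ((**) A ^^ k) (mat 1)"
  show "(\<lambda>k. if k < n then 0 else ?a k) sums (mat_exp (h *\<^sub>R A) - (\<Sum>k<n. ?a k))"
    using sums_diff[OF mat_exp_scaleR_sums sums_If_finite_set[of "{..<n}" ?a]]
    by (rule back_subst[of "\<lambda>f. f sums _"]) (auto simp: fun_eq_iff)
  fix k
  have "norm (?a k) \<le> h ^ n / fact k * (entry_sum A ^ k * entry_sum (mat 1 :: real^'n^'n))" if "k \<ge> n"
    unfolding norm_scaleR
    using assms that order_trans[OF norm_le_entry_sum entry_sum_power[of k A]]
    by (intro mult_mono) (auto intro!: divide_right_mono power_decreasing)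
  then show "norm (if k < n then 0 else ?a k)
      \<le> h ^ n * entry_sum (mat 1 :: real^'n^'n) * (entry_sum A ^ k / fact k)"
    using assms by (auto simp: field_simps)
qed

text \<open>Telescoping in noncommutative form: one factor \<open>A\<close> is split off on the
  left, leaving \<open>A - B\<close> applied to a power of \<open>B\<close>. The assumption
  \<open>1 \<le> M\<close> lets \<open>M ^ k\<close> grow to \<open>M ^ Suc k\<close> in the second
  summand, so each step adds one copy.\<close>

lemma entry_sum_power_diff:
  fixes A B :: "real^'n^'n"
  assumes "entry_sum A \<le> M" "entry_sum B \<le> M" "1 \<le> M"
  shows "entry_sum (((**) A ^^ k) (mat 1) - ((**) B ^^ k) (mat 1))
    \<le> real k * M ^ k * (entry_sum (A - B) * entry_sum (mat 1 :: real^'n^'n))"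
proof (induction k)
  case 0
  then show ?case by (simp add: entry_sum_def)
next
  case (Suc k)
  let ?d = "entry_sum (A - B)" and ?e = "entry_sum (mat 1 :: real^'n^'n)"
  let ?A = "((**) A ^^ k) (mat 1)" and ?B = "((**) B ^^ k) (mat 1)"
  have "((**) A ^^ Suc k) (mat 1) - ((**) B ^^ Suc k) (mat 1) = A ** (?A - ?B) + (A - B) ** ?B"
    by (simp add: matrix_matrix_mult_def vec_eq_iff sum.distrib[symmetric] sum_subtractf[symmetric] algebra_simps)
  then have "entry_sum (((**) A ^^ Suc k) (mat 1) - ((**) B ^^ Suc k) (mat 1))
      \<le> entry_sum A * entry_sum (?A - ?B) + ?d * entry_sum ?B"
    by (simp only:) (intro order_trans[OF entry_sum_add] add_mono entry_sum_mult)
  also have "\<dots> \<le> M * (real k * M ^ k * (?d * ?e)) + ?d * (M ^ k * ?e)"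
    using assms
    by (intro add_mono mult_mono Suc order_trans[OF entry_sum_power[of k B]] power_mono order_refl) auto
  also have "?d * (M ^ k * ?e) \<le> M ^ Suc k * (?d * ?e)"
    using mult_right_mono[OF power_increasing[of k "Suc k" M], of "?d * ?e"] assms(3)
    by (simp add: mult.left_commute)
  finally show ?case by (simp add: algebra_simps)
qed

text \<open>The series are compared term by term. The terms for \<open>k = 0\<close> cancel, so all
  remaining ones keep a factor \<open>h\<close>; this factor pays for the division by
  \<open>h\<close> in the increment function.\<close>

lemma mat_exp_lipschitz:
  fixes A B :: "real^'n^'n"
  assumes "0 < h" "h \<le> 1" "entry_sum A \<le> M" "entry_sum B \<le> M" "1 \<le> M"
  shows "norm (mat_exp (h *\<^sub>R A) - mat_exp (h *\<^sub>R B))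
    \<le> h * (entry_sum (A - B) * entry_sum (mat 1 :: real^'n^'n)) * exp (2 * M)"
proof (rule norm_sums_le_exp)
  let ?c = "entry_sum (A - B) * entry_sum (mat 1 :: real^'n^'n)"
  let ?a = "\<lambda>A k. (h ^ k / fact k) *\<^sub>R ((**) A ^^ k) (mat 1) :: real^'n^'n"
  show "(\<lambda>k. ?a A k - ?a B k) sums (mat_exp (h *\<^sub>R A) - mat_exp (h *\<^sub>R B))"
    by (intro sums_diff mat_exp_scaleR_sums)
  fix k
  have c: "0 \<le> ?c" by simp
  have "norm (((**) A ^^ k) (mat 1) - ((**) B ^^ k) (mat 1)) \<le> real k * M ^ k * ?c"
    by (rule order_trans[OF norm_le_entry_sum entry_sum_power_diff[OF assms(3-5)]])
  \<comment> \<open>\<open>k \<le> 2 ^ k\<close> absorbs the factor from the power difference into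
    the base, whence \<open>exp (2 * M)\<close>.\<close>
  also have "\<dots> \<le> 2 ^ k * M ^ k * ?c"
    using assms(5) c by (intro mult_right_mono) (auto intro: less_imp_le)
  finally have le: "norm (((**) A ^^ k) (mat 1) - ((**) B ^^ k) (mat 1)) \<le> (2 * M) ^ k * ?c"
    by (simp add: power_mult_distrib)
  show "norm (?a A k - ?a B k) \<le> h * ?c * ((2 * M) ^ k / fact k)"
  proof (cases k)
    case 0
    then show ?thesis using assms c by simp
  next
    case (Suc j)
    have "h ^ k \<le> h ^ 1" using assms Suc by (intro power_decreasing) auto
    then have "norm (?a A k - ?a B k) \<le> h / fact k * ((2 * M) ^ k * ?c)"
      unfolding scaleR_diff_right[symmetric] norm_scaleR using assms le
      by (intro mult_mono) (auto intro!: divide_right_mono)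
    then show ?thesis by (simp add: field_simps)
  qed
qed

text \<open>The difference quotient is the increment of a rotation per unit of time. Its bounds stay
  uniform as \<open>h\<close> tends to 0 because both the tail from \<open>n = 1\<close> and the
  Lipschitz estimate carry a factor \<open>h\<close>.\<close>

lemma ulip_mat_exp:
  "ulip {0<..1} (cball 0 R) (\<lambda>h A. mat_exp (h *\<^sub>R A) :: real^'n^'n)"
  and ulip_mat_exp_quotient:
  "ulip {0<..1} (cball 0 R) (\<lambda>h A. (1 / h) *\<^sub>R (mat_exp (h *\<^sub>R A) - mat 1) :: real^'n^'n)"
proof -
  define c where "c = real (CARD('n) * CARD('n))"
  define e where "e = entry_sum (mat 1 :: real^'n^'n)"
  define M where "M = max 1 (c * R)"
  have c: "entry_sum A \<le> c * norm A" for A :: "real^'n^'n"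
    unfolding c_def by (rule entry_sum_le_norm)
  have [simp]: "0 \<le> c" "0 \<le> e" by (simp_all add: c_def e_def)
  have M: "entry_sum A \<le> M" if "A \<in> cball 0 R" for A :: "real^'n^'n"
    using order_trans[OF c[of A] mult_left_mono[of "norm A" R c]] that by (simp add: M_def)
  have lip: "norm (mat_exp (h *\<^sub>R A) - mat_exp (h *\<^sub>R A')) \<le> h * (c * e * exp (2 * M) * norm (A - A'))"
    if "h \<in> {0<..1}" "A \<in> cball 0 R" "A' \<in> cball 0 R" for h :: real and A A' :: "real^'n^'n"
  proof -
    have "norm (mat_exp (h *\<^sub>R A) - mat_exp (h *\<^sub>R A')) \<le> h * (entry_sum (A - A') * e) * exp (2 * M)"
      unfolding e_def using that by (intro mat_exp_lipschitz M) (auto simp: M_def)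
    also have "\<dots> \<le> h * ((c * norm (A - A')) * e) * exp (2 * M)"
      using that by (intro mult_right_mono mult_left_mono c) auto
    finally show ?thesis by (simp add: algebra_simps)
  qed
  have bd: "norm (mat_exp (h *\<^sub>R A)) \<le> e * exp M"
    if "h \<in> {0<..1}" "A \<in> cball 0 R" for h :: real and A :: "real^'n^'n"
    using that mat_exp_tail[of h A 0] order_trans[OF _ mult_left_mono[of "exp (entry_sum A)" "exp M" e]] M[OF that(2)]
    by (simp add: e_def)
  have bd1: "norm (mat_exp (h *\<^sub>R A) - mat 1) \<le> h * (e * exp M)"
    if "h \<in> {0<..1}" "A \<in> cball 0 R" for h :: real and A :: "real^'n^'n"
    using that mat_exp_tail[of h A 1] order_trans[OF _ mult_left_mono[of "exp (entry_sum A)" "exp M" "h * e"]] M[OF that(2)]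
    by (simp add: e_def mult.assoc)
  show "ulip {0<..1} (cball 0 R) (\<lambda>h A. mat_exp (h *\<^sub>R A) :: real^'n^'n)"
  proof (rule ulipI[OF bd])
    fix h :: real and A A' :: "real^'n^'n" assume *: "h \<in> {0<..1}" "A \<in> cball 0 R" "A' \<in> cball 0 R"
    have "h * (c * e * exp (2 * M) * norm (A - A')) \<le> 1 * (c * e * exp (2 * M) * norm (A - A'))"
      using * by (intro mult_right_mono) auto
    then show "norm (mat_exp (h *\<^sub>R A) - mat_exp (h *\<^sub>R A')) \<le> (c * e * exp (2 * M)) * norm (A - A')"
      using lip[OF *] by simp
  qed
  show "ulip {0<..1} (cball 0 R) (\<lambda>h A. (1 / h) *\<^sub>R (mat_exp (h *\<^sub>R A) - mat 1) :: real^'n^'n)"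
  proof (rule ulipI)
    fix h :: real and A A' :: "real^'n^'n" assume *: "h \<in> {0<..1}" "A \<in> cball 0 R" "A' \<in> cball 0 R"
    show "norm ((1 / h) *\<^sub>R (mat_exp (h *\<^sub>R A) - mat 1) - (1 / h) *\<^sub>R (mat_exp (h *\<^sub>R A') - mat 1))
        \<le> (c * e * exp (2 * M)) * norm (A - A')"
      unfolding scaleR_diff_right[symmetric] norm_scaleR using lip[OF *] * by (simp add: field_simps)
  next
    fix h :: real and A :: "real^'n^'n" assume *: "h \<in> {0<..1}" "A \<in> cball 0 R"
    show "norm ((1 / h) *\<^sub>R (mat_exp (h *\<^sub>R A) - mat 1)) \<le> e * exp M"
      using bd1[OF *] * unfolding norm_scaleR by (simp add: field_simps)
  qed
qed

section \<open>Uniform order estimates\<close>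

text \<open>The constant is chosen before both \<open>h\<close> and \<open>t\<close>, so that one
  local estimate holds at all grid points; \<open>t + h \<le> T\<close> keeps the whole step inside
  the interval of the solution.\<close>

definition bigO :: "real \<Rightarrow> nat \<Rightarrow> (real \<Rightarrow> real \<Rightarrow> 'b::real_normed_vector) \<Rightarrow> bool" where
  "bigO T k f \<longleftrightarrow> (\<exists>C. \<forall>h t. 0 < h \<and> h \<le> 1 \<and> 0 \<le> t \<and> t + h \<le> T \<longrightarrow> norm (f h t) \<le> C * h ^ k)"

lemma bigOE:
  assumes "bigO T k f"
  obtains C where "C > 0"
    "\<And>h t. 0 < h \<Longrightarrow> h \<le> 1 \<Longrightarrow> 0 \<le> t \<Longrightarrow> t + h \<le> T \<Longrightarrow> norm (f h t) \<le> C * h ^ k"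
proof -
  obtain C where C: "\<And>h t. 0 < h \<Longrightarrow> h \<le> 1 \<Longrightarrow> 0 \<le> t \<Longrightarrow> t + h \<le> T \<Longrightarrow> norm (f h t) \<le> C * h ^ k"
    using assms unfolding bigO_def by blast
  show thesis
  proof (rule that[of "max C 1"])
    fix h t assume *: "0 < h" "h \<le> 1" "0 \<le> t" "t + h \<le> T"
    show "norm (f h t) \<le> max C 1 * h ^ k"
      by (rule order_trans[OF C[OF *]]) (use * in \<open>simp add: mult_right_mono\<close>)
  qed simp
qed

lemma bigOI:
  assumes "\<And>h t. 0 < h \<Longrightarrow> h \<le> 1 \<Longrightarrow> 0 \<le> t \<Longrightarrow> t + h \<le> T \<Longrightarrow> norm (f h t) \<le> C * h ^ k"
  shows "bigO T k f"
  unfolding bigO_def using assms by blast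

lemma bigO_cong:
  assumes "bigO T k f" "\<And>h t. 0 < h \<Longrightarrow> h \<le> 1 \<Longrightarrow> 0 \<le> t \<Longrightarrow> t + h \<le> T \<Longrightarrow> f h t = g h t"
  shows "bigO T k g"
  using assms unfolding bigO_def by metis

lemma bigO_mono:
  assumes "bigO T k f" "l \<le> k"
  shows "bigO T l f"
proof -
  obtain C where C: "C > 0"
    "\<And>h t. 0 < h \<Longrightarrow> h \<le> 1 \<Longrightarrow> 0 \<le> t \<Longrightarrow> t + h \<le> T \<Longrightarrow> norm (f h t) \<le> C * h ^ k"
    using bigOE[OF assms(1)] by metis
  show ?thesis
  proof (rule bigOI)
    fix h t assume *: "0 < h" "h \<le> 1" "0 \<le> t" "t + h \<le> T"
    have "C * h ^ k \<le> C * h ^ l"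
      using * C(1) assms(2) by (simp add: power_decreasing)
    then show "norm (f h t) \<le> C * h ^ l" using C(2)[OF *] by linarith
  qed
qed

lemma bigO_add:
  assumes "bigO T k f" "bigO T k g"
  shows "bigO T k (\<lambda>h t. f h t + g h t)"
proof -
  obtain C where C: "\<And>h t. 0 < h \<Longrightarrow> h \<le> 1 \<Longrightarrow> 0 \<le> t \<Longrightarrow> t + h \<le> T \<Longrightarrow> norm (f h t) \<le> C * h ^ k"
    using bigOE[OF assms(1)] by metis
  obtain D where D: "\<And>h t. 0 < h \<Longrightarrow> h \<le> 1 \<Longrightarrow> 0 \<le> t \<Longrightarrow> t + h \<le> T \<Longrightarrow> norm (g h t) \<le> D * h ^ k"
    using bigOE[OF assms(2)] by metis
  show ?thesis
  proof (rule bigOI)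
    fix h t assume *: "0 < h" "h \<le> 1" "0 \<le> t" "t + h \<le> T"
    show "norm (f h t + g h t) \<le> (C + D) * h ^ k"
      using norm_triangle_le[OF add_mono[OF C[OF *] D[OF *]]] by (simp add: algebra_simps)
  qed
qed

lemma bigO_bilinear:
  assumes "bounded_bilinear bl" "bigO T k f" "bigO T l g"
  shows "bigO T (k + l) (\<lambda>h t. bl (f h t) (g h t))"
proof -
  interpret bounded_bilinear bl by fact
  obtain K where K: "K > 0" "\<And>a b. norm (bl a b) \<le> norm a * norm b * K"
    using pos_bounded by metis
  obtain C where C: "C > 0" "\<And>h t. 0 < h \<Longrightarrow> h \<le> 1 \<Longrightarrow> 0 \<le> t \<Longrightarrow> t + h \<le> T \<Longrightarrow> norm (f h t) \<le> C * h ^ k"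
    using bigOE[OF assms(2)] by metis
  obtain D where D: "D > 0" "\<And>h t. 0 < h \<Longrightarrow> h \<le> 1 \<Longrightarrow> 0 \<le> t \<Longrightarrow> t + h \<le> T \<Longrightarrow> norm (g h t) \<le> D * h ^ l"
    using bigOE[OF assms(3)] by metis
  show ?thesis
  proof (rule bigOI)
    fix h t assume *: "0 < h" "h \<le> 1" "0 \<le> t" "t + h \<le> T"
    have "norm (bl (f h t) (g h t)) \<le> (C * h ^ k) * (D * h ^ l) * K"
      using K(1) C(1) * by (intro order_trans[OF K(2)] mult_right_mono mult_mono C D) auto
    then show "norm (bl (f h t) (g h t)) \<le> (C * D * K) * h ^ (k + l)"
      by (simp add: power_add mult.commute mult.left_commute)
  qed
qed

lemma bigO_h: "bigO T 1 (\<lambda>h t. h)"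
  by (rule bigOI[where C = 1]) simp

lemma bigO_const: "bigO T 0 (\<lambda>h t. c)"
  by (rule bigOI[where C = "norm c"]) simp

lemmas bigO_scaleR_gen = bigO_bilinear[OF bounded_bilinear_scaleR]

lemma bigO_scaleR: "bigO T k f \<Longrightarrow> bigO T k (\<lambda>h t. c *\<^sub>R f h t)"
  using bigO_scaleR_gen[OF bigO_const] by fastforce

lemma bigO_minus: "bigO T k f \<Longrightarrow> bigO T k (\<lambda>h t. - f h t)"
  using bigO_scaleR[where c = "-1"] by fastforce

lemma bigO_diff: "bigO T k f \<Longrightarrow> bigO T k g \<Longrightarrow> bigO T k (\<lambda>h t. f h t - g h t)"
  using bigO_add[OF _ bigO_minus] by fastforce

text \<open>Multiplication by \<open>h\<close> raises the order by one, and \<open>l\<close> leaves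
  room to lower it again. Later terms are written with \<open>1 * h\<close> or
  \<open>(1/2) * h\<close> to fit the shape \<open>c * h\<close>.\<close>

lemma bigO_scaleR_h: "bigO T k f \<Longrightarrow> l \<le> Suc k \<Longrightarrow> bigO T l (\<lambda>h t. (c * h) *\<^sub>R f h t)"
  using bigO_mono[OF bigO_scaleR[OF bigO_scaleR_gen[OF bigO_h]], of T k f l c] by simp

lemma bigO_scaleR_h2:
  assumes "bigO T k f" "l \<le> Suc (Suc k)"
  shows "bigO T l (\<lambda>h t. (c * h\<^sup>2) *\<^sub>R f h t)"
  using bigO_scaleR_h[OF bigO_scaleR_h[OF assms(1) order_refl, of 1] assms(2), of c]
  by (simp add: power2_eq_square algebra_simps)

lemma bigO_trans:
  "bigO T k (\<lambda>h t. f h t - g h t) \<Longrightarrow> bigO T k (\<lambda>h t. g h t - u h t) \<Longrightarrow> bigO T k (\<lambda>h t. f h t - u h t)"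
  using bigO_add[of T k "\<lambda>h t. f h t - g h t" "\<lambda>h t. g h t - u h t"] by simp

lemma bigO_sym: "bigO T k (\<lambda>h t. f h t - g h t) \<Longrightarrow> bigO T k (\<lambda>h t. g h t - f h t)"
  using bigO_minus[of T k "\<lambda>h t. f h t - g h t"] by simp

lemma bigO_0I: "bigO T k (\<lambda>h t. f h t - g h t) \<Longrightarrow> bigO T 0 g \<Longrightarrow> bigO T 0 f"
  using bigO_add[OF bigO_mono[of T k "\<lambda>h t. f h t - g h t" 0], of g] by simp

lemma bigO_linear:
  assumes "bounded_linear L" "bigO T k f"
  shows "bigO T k (\<lambda>h t. L (f h t))"
  using bigO_bilinear[OF bounded_bilinear.comp[OF bounded_bilinear_scaleR bounded_linear_ident assms(1)]
      bigO_const[of T 1] assms(2)] by simp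

lemma bigO_Pair:
  assumes "bigO T k f" "bigO T k g"
  shows "bigO T k (\<lambda>h t. (f h t, g h t))"
proof -
  have "bigO T k (\<lambda>h t. (f h t, 0) + (0, g h t))"
    by (intro bigO_add bigO_linear[OF _ assms(1)] bigO_linear[OF _ assms(2)]
        bounded_linear_Pair bounded_linear_ident bounded_linear_zero)
  then show ?thesis by simp
qed

lemma bigO_bilinear_diff:
  assumes bl: "bounded_bilinear bl" and f: "bigO T k (\<lambda>h t. f h t - f' h t)" "bigO T 0 f'"
    and g: "bigO T k (\<lambda>h t. g h t - g' h t)" "bigO T 0 g'"
  shows "bigO T k (\<lambda>h t. bl (f h t) (g h t) - bl (f' h t) (g' h t))"
proof -
  interpret bounded_bilinear bl by fact
  have "bigO T 0 g" using g by (rule bigO_0I)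
  have "bigO T (k + 0) (\<lambda>h t. bl (f h t - f' h t) (g h t))" "bigO T (0 + k) (\<lambda>h t. bl (f' h t) (g h t - g' h t))"
    by (rule bigO_bilinear[OF bl]; fact)+
  from bigO_add[OF this[simplified]] show ?thesis by (simp add: diff_left diff_right)
qed

lemma bigO_ulip:
  assumes "\<And>R. ulip {0<..1} (cball 0 R) g" "bigO T 0 f"
  shows "bigO T 0 (\<lambda>h t. g h (f h t))"
proof -
  obtain C where C: "\<And>h t. 0 < h \<Longrightarrow> h \<le> 1 \<Longrightarrow> 0 \<le> t \<Longrightarrow> t + h \<le> T \<Longrightarrow> norm (f h t) \<le> C * h ^ 0"
    using bigOE[OF assms(2)] by metis
  obtain L where L: "\<And>h z. h \<in> {0<..1} \<Longrightarrow> z \<in> cball 0 C \<Longrightarrow> norm (g h z) \<le> L"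
    using ulipE[OF assms(1)[of C]] by metis
  show ?thesis
    by (rule bigOI[where C = L]) (use C L in auto)
qed

text \<open>Both arguments are bounded uniformly in \<open>h\<close> and \<open>t\<close>, so a
  single ball, and with it a single Lipschitz constant of \<open>g\<close>, covers all of them and
  the order \<open>k\<close> is inherited.\<close>

lemma bigO_ulip_diff:
  assumes "\<And>R. ulip {0<..1} (cball 0 R) g" "bigO T k (\<lambda>h t. f h t - f' h t)" "bigO T 0 f'"
  shows "bigO T k (\<lambda>h t. g h (f h t) - g h (f' h t))"
proof -
  have "bigO T 0 f" using assms(2,3) by (rule bigO_0I)
  then obtain C where C: "\<And>h t. 0 < h \<Longrightarrow> h \<le> 1 \<Longrightarrow> 0 \<le> t \<Longrightarrow> t + h \<le> T \<Longrightarrow> norm (f h t) \<le> C * h ^ 0"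
    using bigOE by metis
  obtain D where D: "\<And>h t. 0 < h \<Longrightarrow> h \<le> 1 \<Longrightarrow> 0 \<le> t \<Longrightarrow> t + h \<le> T \<Longrightarrow> norm (f' h t) \<le> D * h ^ 0"
    using bigOE[OF assms(3)] by metis
  obtain K where K: "\<And>h t. 0 < h \<Longrightarrow> h \<le> 1 \<Longrightarrow> 0 \<le> t \<Longrightarrow> t + h \<le> T \<Longrightarrow> norm (f h t - f' h t) \<le> K * h ^ k"
    using bigOE[OF assms(2)] by metis
  define R where "R = max C D"
  obtain L where L: "L > 0" "\<And>h z z'. h \<in> {0<..1} \<Longrightarrow> z \<in> cball 0 R \<Longrightarrow> z' \<in> cball 0 R \<Longrightarrow>
      norm (g h z - g h z') \<le> L * norm (z - z')"
    using ulipE[OF assms(1)[of R]] by metis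
  show ?thesis
  proof (rule bigOI)
    fix h t assume *: "0 < h" "h \<le> 1" "0 \<le> t" "t + h \<le> T"
    have "norm (g h (f h t) - g h (f' h t)) \<le> L * norm (f h t - f' h t)"
      using * C[OF *] D[OF *] by (intro L(2)) (auto simp: R_def)
    also have "\<dots> \<le> L * (K * h ^ k)" using L(1) by (intro mult_left_mono K *) auto
    finally show "norm (g h (f h t) - g h (f' h t)) \<le> (L * K) * h ^ k" by simp
  qed
qed

section \<open>Taylor expansions along a trajectory\<close>

text \<open>Encoded through \<open>ulip\<close> with a dummy parameter so that its closure rules
  apply to functions of time. The parameter set is nonempty, which keeps the bounds from being
  vacuous.\<close>

definition lip_path :: "real \<Rightarrow> (real \<Rightarrow> 'b::real_normed_vector) \<Rightarrow> bool" where
  "lip_path T f \<longleftrightarrow> ulip {0<..1::real} {0..T} (\<lambda>_. f)"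

definition path_deriv :: "real \<Rightarrow> (real \<Rightarrow> 'b::real_normed_vector) \<Rightarrow> (real \<Rightarrow> 'b) \<Rightarrow> bool" where
  "path_deriv T f f' \<longleftrightarrow> (\<forall>t\<in>{0..T}. (f has_vector_derivative f' t) (at t within {0..T}))"

lemma path_deriv_within:
  "path_deriv T f f' \<Longrightarrow> s \<in> {a..b} \<Longrightarrow> 0 \<le> a \<Longrightarrow> b \<le> T \<Longrightarrow>
    (f has_vector_derivative f' s) (at s within {a..b})"
  unfolding path_deriv_def by (rule has_vector_derivative_within_subset[where S = "{0..T}"]) auto

lemma mean_value_bound:
  fixes f :: "real \<Rightarrow> 'b::real_normed_vector"
  assumes der: "\<And>s. s \<in> {a..b} \<Longrightarrow> (f has_vector_derivative f' s) (at s within {a..b})"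
    and bd: "\<And>s. s \<in> {a..b} \<Longrightarrow> norm (f' s) \<le> K" and ab: "a \<le> b"
  shows "norm (f b - f a) \<le> K * (b - a)"
proof -
  have "norm (f b - f a) \<le> K * norm (b - a)"
  proof (rule differentiable_bound[of "{a..b}" f "\<lambda>s d. d *\<^sub>R f' s"])
    show "onorm (\<lambda>d. d *\<^sub>R f' s) \<le> K" if "s \<in> {a..b}" for s
      using bd[OF that] by (intro onorm_le[THEN order_trans])
        (auto intro!: onorm_bound order_trans[OF norm_ge_zero] simp: mult.commute mult_right_mono)
  qed (use der ab in \<open>auto simp: has_vector_derivative_def\<close>)
  then show ?thesis using ab by simp
qed

lemma path_deriv_bounded:
  assumes "path_deriv T f f'"
  shows "bounded (f ` {0..T})"
  using assms unfolding path_deriv_def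
  by (intro compact_imp_bounded compact_continuous_image continuous_on_vector_derivative) auto

lemma lip_pathI:
  assumes der: "path_deriv T f f'" and bd: "bounded (f' ` {0..T})"
  shows "lip_path T f"
proof -
  obtain K where "\<forall>u \<in> f' ` {0..T}. norm u \<le> K" using bd unfolding bounded_iff by blast
  then have K: "norm (f' t) \<le> K" if "t \<in> {0..T}" for t using that by auto
  obtain M where "\<forall>u \<in> f ` {0..T}. norm u \<le> M"
    using path_deriv_bounded[OF der] unfolding bounded_iff by blast
  then have M: "norm (f t) \<le> M" if "t \<in> {0..T}" for t using that by auto
  have le: "norm (f b - f a) \<le> K * (b - a)" if "0 \<le> a" "a \<le> b" "b \<le> T" for a b
  proof (rule mean_value_bound)
    show "(f has_vector_derivative f' s) (at s within {a..b})" if "s \<in> {a..b}" for s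
      using der that \<open>0 \<le> a\<close> \<open>b \<le> T\<close> by (rule path_deriv_within)
  qed (use that K in auto)
  show ?thesis unfolding lip_path_def
  proof (rule ulipI)
    show "norm (f s - f t) \<le> K * norm (s - t)" if "s \<in> {0..T}" "t \<in> {0..T}" for s t
      using le[of s t] le[of t s] that by (cases s t rule: linorder_cases) (auto simp: norm_minus_commute)
  qed (use M in auto)
qed

lemma lip_pathE:
  assumes "lip_path T f"
  obtains L where "L > 0" "\<And>t. t \<in> {0..T} \<Longrightarrow> norm (f t) \<le> L"
    "\<And>s t. s \<in> {0..T} \<Longrightarrow> t \<in> {0..T} \<Longrightarrow> norm (f s - f t) \<le> L * \<bar>s - t\<bar>"
  using ulipE[OF assms[unfolded lip_path_def]]
  by (metis greaterThanAtMost_iff order_refl real_norm_def zero_less_one)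

lemma shift_le: "0 \<le> c \<Longrightarrow> c \<le> 1 \<Longrightarrow> 0 < h \<Longrightarrow> t + h \<le> T \<Longrightarrow> t + c * h \<le> T" for c h t T :: real
  using mult_right_mono[of c 1 h] by linarith

lemma bigO_path:
  assumes "lip_path T f" "0 \<le> c" "c \<le> 1"
  shows "bigO T 0 (\<lambda>h t. f (t + c * h))"
proof -
  obtain L where L: "\<And>t. t \<in> {0..T} \<Longrightarrow> norm (f t) \<le> L" using lip_pathE[OF assms(1)] by metis
  show ?thesis
    by (rule bigOI[where C = L]) (use assms shift_le L in auto)
qed

lemma bigO_path_diff:
  assumes "lip_path T f" "0 \<le> c" "c \<le> 1"
  shows "bigO T 1 (\<lambda>h t. f (t + c * h) - f t)"
proof -
  obtain L where L: "L > 0" "\<And>s t. s \<in> {0..T} \<Longrightarrow> t \<in> {0..T} \<Longrightarrow> norm (f s - f t) \<le> L * \<bar>s - t\<bar>"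
    using lip_pathE[OF assms(1)] by metis
  show ?thesis
  proof (rule bigOI)
    fix h t assume *: "0 < h" "h \<le> 1" "0 \<le> t" "t + h \<le> T"
    have "norm (f (t + c * h) - f t) \<le> L * \<bar>t + c * h - t\<bar>"
      using assms * shift_le[OF assms(2,3) *(1,4)] by (intro L) auto
    also have "\<dots> \<le> L * (1 * h)"
      using L * assms by (auto simp: abs_mult)
    finally show "norm (f (t + c * h) - f t) \<le> L * h ^ 1" by simp
  qed
qed

text \<open>Subtracting \<open>(s - t) *\<^sub>R f' t\<close> leaves a function whose derivative
  \<open>f' s - f' t\<close> has norm at most \<open>L * h\<close>; the mean value inequality over a
  length of at most \<open>h\<close> yields the square.\<close>

lemma bigO_taylor1:
  assumes der: "path_deriv T f f'" and lip: "lip_path T f'" and c: "0 \<le> c" "c \<le> 1"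
  shows "bigO T 2 (\<lambda>h t. f (t + c * h) - f t - (c * h) *\<^sub>R f' t)"
proof -
  obtain L where L: "L > 0" "\<And>s t. s \<in> {0..T} \<Longrightarrow> t \<in> {0..T} \<Longrightarrow> norm (f' s - f' t) \<le> L * \<bar>s - t\<bar>"
    using lip_pathE[OF lip] by metis
  show ?thesis
  proof (rule bigOI)
    fix h t assume *: "0 < h" "h \<le> 1" "0 \<le> t" "t + h \<le> T"
    let ?b = "t + c * h"
    have b: "t \<le> ?b" "?b \<le> t + h" "?b \<le> T"
      using * c shift_le[OF c *(1,4)] shift_le[OF c *(1) order_refl] by auto
    have "norm ((f ?b - (?b - t) *\<^sub>R f' t) - (f t - (t - t) *\<^sub>R f' t)) \<le> (L * h) * (?b - t)"
    proof (rule mean_value_bound)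
      fix s assume s: "s \<in> {t..?b}"
      have "(f has_vector_derivative f' s) (at s within {t..?b})"
        using der s *(3) b(3) by (rule path_deriv_within)
      then show "((\<lambda>s. f s - (s - t) *\<^sub>R f' t) has_vector_derivative (f' s - f' t)) (at s within {t..?b})"
        by (auto intro!: derivative_eq_intros)
      have "norm (f' s - f' t) \<le> L * \<bar>s - t\<bar>" using s b * by (intro L) auto
      also have "\<dots> \<le> L * h" using s b L by auto
      finally show "norm (f' s - f' t) \<le> L * h" .
    qed (use b in auto)
    also have "\<dots> \<le> (L * h) * h" using b L * by (intro mult_left_mono) auto
    finally show "norm (f ?b - f t - (c * h) *\<^sub>R f' t) \<le> L * h ^ 2"
      by (simp add: power2_eq_square algebra_simps)
  qed
qed

text \<open>Two nested mean value inequalities: the inner one bounds the derivative of the remainder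
  by \<open>L * h * h\<close>, the outer one contributes the third factor \<open>h\<close>.\<close>

lemma bigO_taylor2:
  assumes der: "path_deriv T f f'" "path_deriv T f' f''" and lip: "lip_path T f''" and c: "0 \<le> c" "c \<le> 1"
  shows "bigO T 3 (\<lambda>h t. f (t + c * h) - f t - (c * h) *\<^sub>R f' t - ((c * h)\<^sup>2 / 2) *\<^sub>R f'' t)"
proof -
  obtain L where L: "L > 0" "\<And>s t. s \<in> {0..T} \<Longrightarrow> t \<in> {0..T} \<Longrightarrow> norm (f'' s - f'' t) \<le> L * \<bar>s - t\<bar>"
    using lip_pathE[OF lip] by metis
  show ?thesis
  proof (rule bigOI)
    fix h t assume *: "0 < h" "h \<le> 1" "0 \<le> t" "t + h \<le> T"
    let ?b = "t + c * h"
    have b: "t \<le> ?b" "?b \<le> t + h" "?b \<le> T"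
      using * c shift_le[OF c *(1,4)] shift_le[OF c *(1) order_refl] by auto
    have sub: "(g has_vector_derivative g' s) (at s within {t..r})"
      if "path_deriv T g g'" "s \<in> {t..r}" "r \<le> ?b" for g g' :: "real \<Rightarrow> 'a" and s r
      using that(1,2) *(3) order_trans[OF that(3) b(3)] by (rule path_deriv_within)
    have "norm ((f ?b - (?b - t) *\<^sub>R f' t - ((?b - t)\<^sup>2 / 2) *\<^sub>R f'' t)
        - (f t - (t - t) *\<^sub>R f' t - ((t - t)\<^sup>2 / 2) *\<^sub>R f'' t)) \<le> (L * h * h) * (?b - t)"
    proof (rule mean_value_bound)
      fix s assume s: "s \<in> {t..?b}"
      show "((\<lambda>s. f s - (s - t) *\<^sub>R f' t - ((s - t)\<^sup>2 / 2) *\<^sub>R f'' t)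
          has_vector_derivative (f' s - f' t - (s - t) *\<^sub>R f'' t)) (at s within {t..?b})"
        by (auto intro!: derivative_eq_intros sub[OF der(1) s])
      have "s - t \<le> h" using s b by simp
      have "norm ((f' s - (s - t) *\<^sub>R f'' t) - (f' t - (t - t) *\<^sub>R f'' t)) \<le> (L * h) * (s - t)"
      proof (rule mean_value_bound)
        fix r assume r: "r \<in> {t..s}"
        show "((\<lambda>r. f' r - (r - t) *\<^sub>R f'' t) has_vector_derivative (f'' r - f'' t)) (at r within {t..s})"
          using s r by (auto intro!: derivative_eq_intros sub[OF der(2)])
        have "norm (f'' r - f'' t) \<le> L * \<bar>r - t\<bar>" using r s b * by (intro L) auto
        also have "\<dots> \<le> L * h" using s b L r by auto
        finally show "norm (f'' r - f'' t) \<le> L * h" .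
      qed (use s in auto)
      also have "(L * h) * (s - t) \<le> (L * h) * h"
        using L(1) *(1) \<open>s - t \<le> h\<close> by (intro mult_left_mono) auto
      finally show "norm (f' s - f' t - (s - t) *\<^sub>R f'' t) \<le> L * h * h" by (simp add: algebra_simps)
    qed (use b in auto)
    also have "\<dots> \<le> (L * h * h) * h" using b L * by (intro mult_left_mono) auto
    finally show "norm (f ?b - f t - (c * h) *\<^sub>R f' t - ((c * h)\<^sup>2 / 2) *\<^sub>R f'' t) \<le> L * h ^ 3"
      by (simp add: power3_eq_cube algebra_simps)
  qed
qed

text \<open>
  Splitting the integrand into a part integrated by the trapezoidal rule and a part integrated by
  the midpoint rule matches the two magnetic half rotations around the electric kick.
\<close>

lemma bigO_quadrature:
  assumes f: "path_deriv T f (\<lambda>t. p t + q t)" and p: "path_deriv T p p'" "lip_path T p'"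
    and q: "path_deriv T q q'" "lip_path T q'"
  shows "bigO T 3 (\<lambda>h t. f (t + h) - f t - (h / 2) *\<^sub>R (p t + p (t + h)) - h *\<^sub>R q (t + h / 2))"
proof -
  have pq: "path_deriv T (\<lambda>t. p t + q t) (\<lambda>t. p' t + q' t)"
    using p(1) q(1) unfolding path_deriv_def by (auto intro!: derivative_intros)
  have "lip_path T (\<lambda>t. p' t + q' t)"
    using p(2) q(2) unfolding lip_path_def by (rule ulip_add)
  then have 1: "bigO T 3 (\<lambda>h t. f (t + h) - f t - h *\<^sub>R (p t + q t) - (h\<^sup>2 / 2) *\<^sub>R (p' t + q' t))"
    using bigO_taylor2[OF f pq, of 1] by simp
  have 2: "bigO T 3 (\<lambda>h t. ((1/2) * h) *\<^sub>R (p (t + h) - p t - h *\<^sub>R p' t))"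
    using bigO_scaleR_h[OF bigO_taylor1[OF p, of 1], of 3 "1/2"] by simp
  have 3: "bigO T 3 (\<lambda>h t. (1 * h) *\<^sub>R (q (t + h / 2) - q t - (h / 2) *\<^sub>R q' t))"
    using bigO_scaleR_h[OF bigO_taylor1[OF q, of "1/2"], of 3 1] by simp
  \<comment> \<open>Both rules reproduce the second-order term: the trapezoidal weight gives
    \<open>(h / 2) * h\<close> and the midpoint weight \<open>h * (h / 2)\<close>, so the
    derivatives \<open>u'\<close> and \<open>r'\<close> cancel against their coefficient
    \<open>h\<^sup>2 / 2\<close>.\<close>
  have eq: "a - (h / 2) *\<^sub>R (u + w) - h *\<^sub>R z
      = (a - h *\<^sub>R (u + r) - (h\<^sup>2 / 2) *\<^sub>R (u' + r'))
        - ((1/2) * h) *\<^sub>R (w - u - h *\<^sub>R u') - (1 * h) *\<^sub>R (z - r - (h / 2) *\<^sub>R r')"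
    for a u w z r u' r' :: 'a and h
  proof -
    have "h *\<^sub>R u = (h / 2) *\<^sub>R u + (h / 2) *\<^sub>R u" by (simp flip: scaleR_left_distrib)
    then show ?thesis by (simp add: algebra_simps power2_eq_square)
  qed
  show ?thesis
    by (rule bigO_cong[OF bigO_diff[OF bigO_diff[OF 1 2] 3]]) (rule eq[symmetric])
qed

lemma bigO_midpoint:
  fixes f q :: "real \<Rightarrow> 'b::real_normed_vector"
  assumes "path_deriv T f q" "path_deriv T q q'" "lip_path T q'"
  shows "bigO T 3 (\<lambda>h t. f (t + h) - f t - h *\<^sub>R q (t + h / 2))"
proof -
  have "path_deriv T (\<lambda>_. 0 :: 'b) (\<lambda>_. 0)" by (simp add: path_deriv_def)
  from bigO_quadrature[OF _ this _ assms(2,3)] assms(1) show ?thesis by (simp add: lip_path_def)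
qed

lemma bigO_0_path: "lip_path T f \<Longrightarrow> bigO T 0 (\<lambda>h t. f t)"
  and bigO_0_path1: "lip_path T f \<Longrightarrow> bigO T 0 (\<lambda>h t. f (t + h))"
  and bigO_0_pathm: "lip_path T f \<Longrightarrow> bigO T 0 (\<lambda>h t. f (t + h / 2))"
  using bigO_path[of T f 0] bigO_path[of T f 1] bigO_path[of T f "1/2"] by simp_all

section \<open>Convergence of one-step methods\<close>

text \<open>Discrete Gronwall with a bootstrap: the increment is Lipschitz only on balls, so the
  induction on \<open>n\<close> must also show that the numerical solution stays within distance 1
  of the exact one. This is where \<open>h\<close> has to be small.\<close>

lemma one_step_convergence:
  fixes \<Phi> \<phi> :: "real \<Rightarrow> 'z::real_normed_vector \<Rightarrow> 'z"
  assumes step: "\<And>h z. 0 < h \<Longrightarrow> h \<le> 1 \<Longrightarrow> \<Phi> h z = z + h *\<^sub>R \<phi> h z"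
    and lip: "\<And>R. ulip {0<..1} (cball 0 R) \<phi>"
    and err: "bigO T (Suc p) (\<lambda>h t. \<Phi> h (y t) - y (t + h))"
    and bdd: "bounded (y ` {0..T})" and T: "0 < T" and p: "p > 0"
  shows "\<exists>\<alpha> C. 0 < \<alpha> \<and> \<alpha> \<le> 1 \<and> (\<forall>h n. 0 < h \<and> h \<le> \<alpha> \<and> real n * h \<le> T \<longrightarrow>
     norm ((\<Phi> h ^^ n) (y 0) - y (real n * h)) \<le> C * h ^ p)"
proof -
  obtain M where M: "M > 0" and err_le:
    "\<And>h t. 0 < h \<Longrightarrow> h \<le> 1 \<Longrightarrow> 0 \<le> t \<Longrightarrow> t + h \<le> T \<Longrightarrow> norm (\<Phi> h (y t) - y (t + h)) \<le> M * h ^ Suc p"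
    using bigOE[OF err] by metis
  obtain R where "\<forall>u \<in> y ` {0..T}. norm u \<le> R" using bdd unfolding bounded_iff by blast
  then have R: "norm (y t) \<le> R" if "0 \<le> t" "t \<le> T" for t using that by auto
  obtain L where L: "L > 0" and lip_le: "\<And>h z z'. 0 < h \<Longrightarrow> h \<le> 1 \<Longrightarrow> norm z \<le> R + 1 \<Longrightarrow> norm z' \<le> R + 1 \<Longrightarrow>
      norm (\<phi> h z - \<phi> h z') \<le> L * norm (z - z')"
    using ulipE[OF lip[of "R + 1"]] by (metis greaterThanAtMost_iff mem_cball_0)
  \<comment> \<open>Global bound at the end of the interval: \<open>n\<close> local errors
    \<open>M * h ^ Suc p\<close> with \<open>n * h \<le> T\<close> amount to at most
    \<open>T * M * h ^ p\<close>, amplified by \<open>exp (L * T)\<close>.\<close>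
  define C where "C = T * M * exp (L * T)"
  have C: "C > 0" using T M by (simp add: C_def)
  \<comment> \<open>With \<open>p > 0\<close> and \<open>h \<le> 1\<close> one has
    \<open>C * h ^ p \<le> C * h\<close>, so \<open>h \<le> 1 / C\<close> makes the global error at
    most 1.\<close>
  define \<alpha> where "\<alpha> = min 1 (1 / C)"
  have small: "C * h ^ p \<le> 1" if "0 < h" "h \<le> \<alpha>" for h
  proof -
    have "h ^ p \<le> h ^ 1" using that p by (intro power_decreasing) (auto simp: \<alpha>_def)
    also have "\<dots> \<le> 1 / C" using that by (simp add: \<alpha>_def)
    finally show ?thesis using C by (simp add: field_simps)
  qed
  \<comment> \<open>The induction carries a bound growing with \<open>n\<close>, since the uniform
    bound \<open>C * h ^ p\<close> would not reproduce itself from one step to the next.\<close>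
  have main: "norm ((\<Phi> h ^^ n) (y 0) - y (real n * h)) \<le> real n * (M * h ^ Suc p) * exp (L * (real n * h))"
    (is "?e n \<le> ?b n") if h: "0 < h" "h \<le> \<alpha>" and n: "real n * h \<le> T" for h n
    using n
  proof (induction n)
    case (Suc n)
    have h1: "h \<le> 1" using h by (simp add: \<alpha>_def)
    have nT: "real n * h \<le> T" using Suc.prems h by (simp add: algebra_simps)
    have e: "?e n \<le> ?b n" using Suc.IH nT by blast
    have "?b n = (real n * h) * M * h ^ p * exp (L * (real n * h))" by simp
    also have "\<dots> \<le> T * M * h ^ p * exp (L * T)"
      using nT M L h T by (intro mult_mono) auto
    also have "\<dots> = C * h ^ p" by (simp add: C_def)
    also have "\<dots> \<le> 1" by (rule small[OF h])
    finally have "?e n \<le> 1" using e by linarith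
    let ?z = "(\<Phi> h ^^ n) (y 0)" and ?y = "y (real n * h)"
    have y: "norm ?y \<le> R" using nT h by (intro R) auto
    \<comment> \<open>The induction hypothesis places the numerical solution in the ball of radius
      \<open>R + 1\<close>, on which \<open>L\<close> is a Lipschitz constant of the
      increment.\<close>
    have "norm ?z \<le> R + 1" using y \<open>?e n \<le> 1\<close> by norm
    then have "norm (\<phi> h ?z - \<phi> h ?y) \<le> L * norm (?z - ?y)"
      using lip_le[OF h(1) h1] y by simp
    then have "norm (h *\<^sub>R (\<phi> h ?z - \<phi> h ?y)) \<le> h * (L * norm (?z - ?y))"
      using h by simp
    moreover have "\<Phi> h ?z - \<Phi> h ?y = (?z - ?y) + h *\<^sub>R (\<phi> h ?z - \<phi> h ?y)"
      by (simp add: step[OF h(1) h1] algebra_simps)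
    ultimately have "norm (\<Phi> h ?z - \<Phi> h ?y) \<le> norm (?z - ?y) + h * (L * norm (?z - ?y))"
      by (metis norm_triangle_mono order_refl)
    also have "\<dots> = (1 + L * h) * ?e n" by (simp add: algebra_simps)
    also have "\<dots> \<le> exp (L * h) * ?b n"
      using e exp_ge_add_one_self[of "L * h"] by (intro mult_mono) auto
    also have "\<dots> = real n * (M * h ^ Suc p) * exp (L * (real (Suc n) * h))"
      by (simp add: algebra_simps exp_add)
    finally have 1: "norm (\<Phi> h ?z - \<Phi> h ?y) \<le> real n * (M * h ^ Suc p) * exp (L * (real (Suc n) * h))" .
    have "norm (\<Phi> h ?y - y (real n * h + h)) \<le> M * h ^ Suc p"
      using Suc.prems h h1 by (intro err_le) (auto simp: algebra_simps)
    \<comment> \<open>The local error is padded with the same exponential, so that adding it to the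
      propagated error turns \<open>real n\<close> into \<open>real (Suc n)\<close>.\<close>
    also have "\<dots> \<le> (M * h ^ Suc p) * exp (L * (real (Suc n) * h))"
      using mult_left_mono[of 1 "exp (L * (real (Suc n) * h))" "M * h ^ Suc p"] M h L by simp
    finally have 2: "norm (\<Phi> h ?y - y (real (Suc n) * h)) \<le> (M * h ^ Suc p) * exp (L * (real (Suc n) * h))"
      by (simp add: algebra_simps)
    have "?e (Suc n) \<le> norm (\<Phi> h ?z - \<Phi> h ?y) + norm (\<Phi> h ?y - y (real (Suc n) * h))"
      using norm_triangle_ineq[of "\<Phi> h ?z - \<Phi> h ?y" "\<Phi> h ?y - y (real (Suc n) * h)"] by simp
    also have "\<dots> \<le> ?b (Suc n)" using 1 2 by (simp add: algebra_simps)
    finally show ?case .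
  qed simp
  have "norm ((\<Phi> h ^^ n) (y 0) - y (real n * h)) \<le> C * h ^ p"
    if h: "0 < h" "h \<le> \<alpha>" and n: "real n * h \<le> T" for h n
  proof -
    have "real n * (M * h ^ Suc p) * exp (L * (real n * h)) = (real n * h) * M * h ^ p * exp (L * (real n * h))"
      by simp
    also have "\<dots> \<le> T * M * h ^ p * exp (L * T)"
      using n M L h T by (intro mult_mono) auto
    finally show ?thesis using main[OF h n] by (simp add: C_def mult.commute mult.left_commute)
  qed
  moreover have "0 < \<alpha>" "\<alpha> \<le> 1" using C by (auto simp: \<alpha>_def)
  ultimately show ?thesis by blast
qed

section \<open>Linear algebra of the magnetic rotations\<close>

lemma bounded_bilinear_matrix_vector_mult:
  "bounded_bilinear ((*v) :: real^'n^'m \<Rightarrow> real^'n \<Rightarrow> real^'m)"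
  unfolding bilinear_conv_bounded_bilinear[symmetric] bilinear_def
  by (auto intro!: linearI simp: matrix_vector_mult_add_rdistrib matrix_vector_right_distrib
      scaleR_matrix_vector_assoc matrix_vector_mult_scaleR)

lemmas ulip_matrix_vector = ulip_bilinear[OF bounded_bilinear_matrix_vector_mult]
lemmas bigO_matrix_vector_diff = bigO_bilinear_diff[OF bounded_bilinear_matrix_vector_mult]

lemma bounded_bilinear_cross3: "bounded_bilinear cross3"
  using bilinear_cross bilinear_conv_bounded_bilinear by blast

text \<open>The matrix depends on the position only through the field value, and linearly; this
  transfers Lipschitz bounds from \<open>B\<close> to \<open>B_tilde B\<close>. The point
  \<open>z\<close> is a dummy.\<close>

lemma bounded_linear_B_tilde: "bounded_linear (\<lambda>u. B_tilde (\<lambda>_. u) z)"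
  unfolding linear_conv_bounded_linear[symmetric]
  by (rule linearI) (simp_all add: B_tilde_def vec_eq_iff forall_3)

lemma mat_exp_zero: "mat_exp (0 :: real^'n^'n) = mat 1"
proof -
  have "(\<lambda>k. (0 ^ k / fact k) *\<^sub>R ((**) (0 :: real^'n^'n) ^^ k) (mat 1))
      = (\<lambda>k. if k = 0 then mat 1 else 0)"
    by (auto simp: fun_eq_iff)
  then show ?thesis
    using sums_unique2[OF mat_exp_scaleR_sums[of 0 "0 :: real^'n^'n"]] sums_single[of 0 "\<lambda>_. mat 1 :: real^'n^'n"]
    by (simp add: eq_commute)
qed

lemma bigO_mat_exp_tail:
  fixes A :: "real \<Rightarrow> real \<Rightarrow> real^'n^'n"
  assumes "bigO T 0 A" "bigO T 0 u"
  shows "bigO T n (\<lambda>h t. (mat_exp (h *\<^sub>R A h t)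
    - (\<Sum>k<n. (h ^ k / fact k) *\<^sub>R ((**) (A h t) ^^ k) (mat 1))) *v u h t)"
proof -
  let ?N = "real (CARD('n) * CARD('n))"
  obtain C where C: "C > 0" "\<And>h t. 0 < h \<Longrightarrow> h \<le> 1 \<Longrightarrow> 0 \<le> t \<Longrightarrow> t + h \<le> T \<Longrightarrow> norm (A h t) \<le> C * h ^ 0"
    using bigOE[OF assms(1)] by metis
  have "bigO T n (\<lambda>h t. mat_exp (h *\<^sub>R A h t) - (\<Sum>k<n. (h ^ k / fact k) *\<^sub>R ((**) (A h t) ^^ k) (mat 1)))"
  proof (rule bigOI)
    fix h t assume *: "0 < h" "h \<le> 1" "0 \<le> t" "t + h \<le> T"
    have "entry_sum (A h t) \<le> ?N * C"
      using C(2)[OF *] by (intro order_trans[OF entry_sum_le_norm] mult_left_mono) auto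
    then have "(h ^ n * entry_sum (mat 1 :: real^'n^'n)) * exp (entry_sum (A h t))
        \<le> (h ^ n * entry_sum (mat 1 :: real^'n^'n)) * exp (?N * C)"
      using * by (intro mult_left_mono) auto
    with mat_exp_tail[OF *(1,2), of "A h t" n]
    show "norm (mat_exp (h *\<^sub>R A h t) - (\<Sum>k<n. (h ^ k / fact k) *\<^sub>R ((**) (A h t) ^^ k) (mat 1)))
        \<le> (entry_sum (mat 1 :: real^'n^'n) * exp (?N * C)) * h ^ n"
      by (simp add: algebra_simps)
  qed
  from bigO_bilinear[OF bounded_bilinear_matrix_vector_mult this assms(2)] show ?thesis by simp
qed

lemma
  fixes A :: "real \<Rightarrow> real \<Rightarrow> real^'n^'n"
  assumes "bigO T 0 A" "bigO T 0 u"
  shows bigO_mat_exp1: "bigO T 1 (\<lambda>h t. mat_exp (h *\<^sub>R A h t) *v u h t - u h t)"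
    and bigO_mat_exp2: "bigO T 2 (\<lambda>h t. mat_exp (h *\<^sub>R A h t) *v u h t - u h t - h *\<^sub>R (A h t *v u h t))"
    and bigO_mat_exp3: "bigO T 3 (\<lambda>h t. mat_exp (h *\<^sub>R A h t) *v u h t - u h t - h *\<^sub>R (A h t *v u h t)
      - (h\<^sup>2 / 2) *\<^sub>R (A h t *v (A h t *v u h t)))"
  using bigO_mat_exp_tail[OF assms, of 1] bigO_mat_exp_tail[OF assms, of 2] bigO_mat_exp_tail[OF assms, of 3]
  by (simp_all add: numeral_2_eq_2 numeral_3_eq_3 matrix_vector_mult_diff_rdistrib
      matrix_vector_mult_add_rdistrib scaleR_matrix_vector_assoc[symmetric] matrix_vector_mul_assoc
      diff_diff_eq add.assoc)

lemma bigO_exp: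
  assumes "bigO T 1 d"
  shows "bigO T 2 (\<lambda>h t. exp (d h t) - 1 - d h t :: real)"
proof -
  obtain C where C: "C > 0" "\<And>h t. 0 < h \<Longrightarrow> h \<le> 1 \<Longrightarrow> 0 \<le> t \<Longrightarrow> t + h \<le> T \<Longrightarrow> norm (d h t) \<le> C * h ^ 1"
    using bigOE[OF assms] by metis
  show ?thesis
  proof (rule bigOI)
    fix h t assume *: "0 < h" "h \<le> 1" "0 \<le> t" "t + h \<le> T"
    have "C * h ^ 1 \<le> C * 1" using C(1) * by (intro mult_left_mono) auto
    then have d: "norm (d h t) \<le> C * h" "norm (d h t) \<le> C" using C(2)[OF *] by auto
    have "norm (exp (d h t) - (\<Sum>i\<le>1. d h t ^ i / fact i)) \<le> exp (norm (d h t)) * norm (d h t) ^ Suc 1 / fact 1"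
      by (rule Taylor_exp_field)
    also have "\<dots> \<le> exp C * (C * h) ^ Suc 1 / fact 1"
      using d by (intro divide_right_mono mult_mono power_mono) auto
    finally show "norm (exp (d h t) - 1 - d h t) \<le> (exp C * C\<^sup>2) * h ^ 2"
      by (simp add: power2_eq_square algebra_simps)
  qed
qed

section \<open>The schemes in logarithmic form\<close>

text \<open>Common form of both schemes with \<open>\<rho>\<close> in place of \<open>ln r\<close>:
  \<open>a\<close> and \<open>b\<close> are the fractions of the step rotated before and after the
  kick, \<open>(1, 0)\<close> for S1 and \<open>(1/2, 1/2)\<close> for S2. The update of
  \<open>\<rho>\<close> is additive and avoids the singularity of \<open>ln\<close> at 0.\<close>

definition log_step ::
  "real \<Rightarrow> real \<Rightarrow> (real^3 \<Rightarrow> real) \<Rightarrow> (real^3 \<Rightarrow> real^3) \<Rightarrow> (real^3 \<Rightarrow> real^3) \<Rightarrow> real \<Rightarrow> state \<Rightarrow> state" where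
  "log_step a b U E B h = (\<lambda>(x, v, \<rho>).
     let w = mat_exp (h *\<^sub>R (a *\<^sub>R B_tilde B x)) *v v;
         F = F_step U E h x w (exp \<rho>);
         x' = x + h *\<^sub>R w + (h\<^sup>2 / 2) *\<^sub>R F;
         v' = mat_exp (h *\<^sub>R (b *\<^sub>R B_tilde B x')) *v (w + h *\<^sub>R F)
     in (x', v', \<rho> - (x' - x) \<bullet> F))"

definition of_log :: "state \<Rightarrow> state" where
  "of_log = (\<lambda>(x, v, \<rho>). (x, v, exp \<rho>))"

text \<open>\<open>ln (exp \<rho>) = \<rho>\<close> makes the auxiliary updates agree, and with
  \<open>b = 0\<close> the second rotation is the identity by \<open>mat_exp_zero\<close>.\<close>

lemma S1_step_of_log: "S1_step U E B h (of_log z) = of_log (log_step 1 0 U E B h z)"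
  by (simp add: S1_step_def log_step_def of_log_def Let_def mat_exp_zero split: prod.split)

lemma S2_step_of_log: "S2_step U E B h (of_log z) = of_log (log_step (1/2) (1/2) U E B h z)"
  by (simp add: S2_step_def log_step_def of_log_def Let_def split: prod.split)

lemma funpow_of_log:
  assumes "\<And>z. S (of_log z) = of_log (L z)"
  shows "(S ^^ n) (of_log z) = of_log ((L ^^ n) z)"
  by (induction n) (simp_all add: assms)

lemma pos_of_log [simp]: "pos (of_log z) = fst z" and vel_of_log [simp]: "vel (of_log z) = fst (snd z)"
  by (simp_all add: of_log_def split: prod.split)

text \<open>The factor \<open>exp (U xh)\<close> in the predictor of \<open>r\<close> cancels the
  denominator of \<open>F_esav\<close>, and the remaining quotient merges into one exponential. In
  this division-free form the closure rules for \<open>ulip\<close> apply.\<close>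

lemma F_step_exp:
  "F_step U E h x w (exp \<rho>) =
    (exp (\<rho> - U (x + (h / 2) *\<^sub>R w)) - h / 2 * (w \<bullet> E (x + (h / 2) *\<^sub>R w))) *\<^sub>R E (x + (h / 2) *\<^sub>R w)"
  by (simp add: F_step_def F_esav_def Let_def exp_diff diff_divide_distrib)

section \<open>The increment function of the schemes and its uniform Lipschitz bounds\<close>

locale cpd =
  fixes U :: "real^3 \<Rightarrow> real" and E B :: "real^3 \<Rightarrow> real^3"
    and T :: real and x v :: "real \<Rightarrow> real^3"
  assumes E_grad: "\<And>z. GDERIV U z :> - E z"
    and E_smooth: "Ck 2 E"
    and B_smooth: "Ck 2 B"
    and T_pos: "T > 0"
    and x_deriv: "path_deriv T x v"
    and v_deriv: "path_deriv T v (\<lambda>t. cross3 (v t) (B (x t)) + E (x t))"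
begin

lemma ulip_E: "ulip P (cball 0 R) (\<lambda>p. E)"
  using E_smooth unfolding numeral_2_eq_2 by (rule ulip_Ck)

lemma ulip_B: "ulip P (cball 0 R) (\<lambda>p. B)"
  using B_smooth unfolding numeral_2_eq_2 by (rule ulip_Ck)

lemma U_derivative: "(U has_derivative (\<lambda>d. d \<bullet> - E z)) (at z)"
  using E_grad by (simp add: gderiv_def)

lemma ulip_U: "ulip P (cball 0 R) (\<lambda>p. U)"
proof (rule ulip_C1[OF U_derivative])
  have "continuous_on UNIV E"
    using E_smooth unfolding numeral_2_eq_2
    by (auto intro!: continuous_at_imp_continuous_on differentiable_imp_continuous_within)
  then show "continuous_on UNIV (\<lambda>z. d \<bullet> - E z)" for d by (intro continuous_intros)
qed

lemma ulip_B_tilde: "ulip P (cball 0 R) (\<lambda>p. B_tilde B)"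
proof -
  have "B_tilde B = (\<lambda>y. B_tilde (\<lambda>_. B y) 0)" by (simp add: B_tilde_def fun_eq_iff)
  then show ?thesis using ulip_linear[OF bounded_linear_B_tilde ulip_B] by simp
qed

lemma ulip_F_step:
  assumes X: "ulip {0<..1} S X" and W: "ulip {0<..1} S W" and R: "ulip {0<..1} S R"
  shows "ulip {0<..1} S (\<lambda>h z. F_step U E h (X h z) (W h z) (exp (R h z)))"
proof -
  have h: "ulip {0<..1} S (\<lambda>h z. h / 2 :: real)"
    by (rule ulip_param) (auto intro!: boundedI[where B = "1/2"])
  note xh = ulip_add[OF X ulip_scaleR[OF h W]]
  note Eh = ulip_compose[OF xh ulip_E]
  show ?thesis
    unfolding F_step_exp
    by (intro ulip_scaleR ulip_diff Eh ulip_compose[OF _ ulip_exp] ulip_compose[OF xh ulip_U] R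
        ulip_bilinear[OF bounded_bilinear_mult h] ulip_inner W)
qed

text \<open>Each component changes by an explicit multiple of \<open>h\<close>. For the rotations
  the factor is extracted by writing \<open>mat_exp (h *\<^sub>R A)\<close> as the identity plus
  \<open>h\<close> times the quotient \<open>\<psi>\<close>, which
  \<open>ulip_mat_exp_quotient\<close> controls uniformly in \<open>h\<close>.\<close>

lemma log_step_increment:
  obtains \<phi> where "\<And>R. ulip {0<..1} (cball 0 R) \<phi>"
    "\<And>h z. 0 < h \<Longrightarrow> h \<le> 1 \<Longrightarrow> log_step a b U E B h z = z + h *\<^sub>R \<phi> h z"
proof -
  define \<psi> :: "real \<Rightarrow> real^3^3 \<Rightarrow> real^3^3" where "\<psi> h A = (1 / h) *\<^sub>R (mat_exp (h *\<^sub>R A) - mat 1)" for h A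
  have \<psi>: "mat_exp (h *\<^sub>R A) *v u = u + h *\<^sub>R (\<psi> h A *v u)" if "0 < h" for h A u
    using that by (simp add: \<psi>_def scaleR_matrix_vector_assoc matrix_vector_mult_diff_rdistrib)
  define Y where "Y = (\<lambda>(h::real) (z::state). fst z)"
  define V where "V = (\<lambda>(h::real) (z::state). fst (snd z))"
  define P where "P = (\<lambda>(h::real) (z::state). snd (snd z))"
  define \<omega> where "\<omega> = (\<lambda>h z. \<psi> h (a *\<^sub>R B_tilde B (Y h z)) *v V h z)"
  define W where "W = (\<lambda>h z. V h z + h *\<^sub>R \<omega> h z)"
  define F where "F = (\<lambda>h z. F_step U E h (Y h z) (W h z) (exp (P h z)))"
  \<comment> \<open>\<open>\<xi>\<close> is the displacement \<open>x' - x\<close> divided by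
    \<open>h\<close>; it also yields the increment of \<open>\<rho>\<close>.\<close>
  define \<xi> where "\<xi> = (\<lambda>h z. W h z + (h / 2) *\<^sub>R F h z)"
  define Y' where "Y' = (\<lambda>h z. Y h z + h *\<^sub>R \<xi> h z)"
  define Q where "Q = (\<lambda>h z. W h z + h *\<^sub>R F h z)"
  define \<phi> where "\<phi> = (\<lambda>h z. (\<xi> h z, \<omega> h z + F h z + \<psi> h (b *\<^sub>R B_tilde B (Y' h z)) *v Q h z, - (\<xi> h z \<bullet> F h z)))"
  show thesis
  proof (rule that)
    fix R
    let ?lip = "ulip {0<..1} (cball 0 R)"
    have h: "?lip (\<lambda>h z. h :: real)" "?lip (\<lambda>h z. h / 2 :: real)"
      by (rule ulip_param, auto intro!: boundedI[where B = 1])+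
    have \<psi>_lip: "?lip (\<lambda>h z. \<psi> h (c *\<^sub>R B_tilde B (G h z)))" if "?lip G"
      for c and G :: "real \<Rightarrow> state \<Rightarrow> real^3"
      unfolding \<psi>_def
      by (rule ulip_compose[OF _ ulip_mat_exp_quotient])
        (intro ulip_scaleR ulip_const ulip_compose[OF that ulip_B_tilde])
    have id: "?lip (\<lambda>h z. z)" by (rule ulip_id) simp
    have Y: "?lip Y" unfolding Y_def by (rule ulip_linear[OF bounded_linear_fst id])
    have V: "?lip V" unfolding V_def
      by (rule ulip_linear[OF bounded_linear_compose[OF bounded_linear_fst bounded_linear_snd] id])
    have P: "?lip P" unfolding P_def
      by (rule ulip_linear[OF bounded_linear_compose[OF bounded_linear_snd bounded_linear_snd] id])
    have \<omega>: "?lip \<omega>" unfolding \<omega>_def by (intro ulip_matrix_vector \<psi>_lip Y V)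
    have W: "?lip W" unfolding W_def by (intro ulip_add ulip_scaleR V h \<omega>)
    have F: "?lip F" unfolding F_def by (intro ulip_F_step Y W P)
    have \<xi>: "?lip \<xi>" unfolding \<xi>_def by (intro ulip_add ulip_scaleR W h F)
    have Y': "?lip Y'" unfolding Y'_def by (intro ulip_add ulip_scaleR Y h \<xi>)
    have Q: "?lip Q" unfolding Q_def by (intro ulip_add ulip_scaleR W h F)
    show "?lip \<phi>" unfolding \<phi>_def
      by (intro ulip_Pair ulip_add ulip_minus ulip_inner ulip_matrix_vector \<psi>_lip \<xi> \<omega> F Y' Q)
  next
    fix h :: real and z :: state assume h: "0 < h" "h \<le> 1"
    have w: "mat_exp (h *\<^sub>R (a *\<^sub>R B_tilde B (Y h z))) *v V h z = W h z"
      unfolding \<psi>[OF h(1)] by (simp add: W_def \<omega>_def)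
    have y: "Y h z + h *\<^sub>R W h z + (h\<^sup>2 / 2) *\<^sub>R F h z = Y' h z"
      by (simp add: Y'_def \<xi>_def algebra_simps power2_eq_square)
    have "log_step a b U E B h z = (Y' h z, mat_exp (h *\<^sub>R (b *\<^sub>R B_tilde B (Y' h z))) *v Q h z,
        P h z - (Y' h z - Y h z) \<bullet> F h z)"
      unfolding log_step_def case_prod_beta Let_def y[symmetric] F_def Q_def w[symmetric]
      by (simp only: Y_def V_def P_def)
    also have "\<dots> = (Y h z, V h z, P h z) + h *\<^sub>R \<phi> h z"
      unfolding \<psi>[OF h(1)] by (simp add: \<phi>_def Y'_def Q_def W_def algebra_simps)
    also have "(Y h z, V h z, P h z) = z" by (simp add: Y_def V_def P_def)
    finally show "log_step a b U E B h z = z + h *\<^sub>R \<phi> h z" .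
  qed
qed


section \<open>Regularity of the exact trajectory and of the fields along it\<close>

lemma lip_path_x: "lip_path T x"
  using x_deriv path_deriv_bounded[OF v_deriv] by (rule lip_pathI)

lemma lip_path_comp: "(\<And>R. ulip {0<..1} (cball 0 R) (\<lambda>_::real. G)) \<Longrightarrow> lip_path T (\<lambda>t. G (x t))"
  using lip_path_x unfolding lip_path_def by (rule ulip_compose)

text \<open>Bootstrap from continuity: \<open>v\<close> is differentiable, hence bounded on the
  compact interval, so the right-hand side of the equation is bounded and \<open>v\<close> is
  Lipschitz.\<close>

lemma lip_path_v: "lip_path T v"
proof (rule lip_pathI[OF v_deriv])
  have bdd: "bounded (v ` {0..T})" by (rule path_deriv_bounded[OF v_deriv])
  then obtain V where "\<forall>u \<in> v ` {0..T}. norm u \<le> V" unfolding bounded_iff by blast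
  then have V: "\<And>t. t \<in> {0..T} \<Longrightarrow> norm (v t) \<le> V" by auto
  obtain b where b: "\<And>t. t \<in> {0..T} \<Longrightarrow> norm (B (x t)) \<le> b"
    using lip_pathE[OF lip_path_comp[OF ulip_B]] by metis
  obtain e where e: "\<And>t. t \<in> {0..T} \<Longrightarrow> norm (E (x t)) \<le> e"
    using lip_pathE[OF lip_path_comp[OF ulip_E]] by metis
  obtain K where K: "K > 0" "\<And>a c. norm (cross3 a c) \<le> norm a * norm c * K"
    using bounded_bilinear.pos_bounded[OF bounded_bilinear_cross3] by metis
  show "bounded ((\<lambda>t. cross3 (v t) (B (x t)) + E (x t)) ` {0..T})"
  proof (rule boundedI)
    fix u assume "u \<in> (\<lambda>t. cross3 (v t) (B (x t)) + E (x t)) ` {0..T}"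
    then obtain t where t: "t \<in> {0..T}" "u = cross3 (v t) (B (x t)) + E (x t)" by auto
    have "norm (cross3 (v t) (B (x t))) \<le> V * b * K"
      using K(1) order_trans[OF norm_ge_zero V[OF t(1)]]
      by (intro order_trans[OF K(2)] mult_right_mono mult_mono V b t) auto
    then show "norm u \<le> V * b * K + e" unfolding t(2) by (intro norm_triangle_mono e t)
  qed
qed

lemma path_deriv_comp:
  assumes "\<And>z. (G has_derivative G' z) (at z)"
  shows "path_deriv T (\<lambda>t. G (x t)) (\<lambda>t. G' (x t) (v t))"
  unfolding path_deriv_def
proof
  fix t assume "t \<in> {0..T}"
  then have "(x has_vector_derivative v t) (at t within {0..T})"
    using x_deriv by (simp add: path_deriv_def)
  from vector_derivative_diff_chain_within[OF this has_derivative_at_withinI[OF assms]]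
  show "((\<lambda>t. G (x t)) has_vector_derivative G' (x t) (v t)) (at t within {0..T})"
    by (simp add: o_def)
qed

text \<open>In the second claim base point and direction both vary with \<open>t\<close>. Expanding
  \<open>v t\<close> in the basis separates them: the derivative of \<open>G\<close> in a fixed
  direction is \<open>Ck (Suc 0)\<close>, hence Lipschitz along \<open>x\<close>.\<close>

lemma path_C2:
  assumes "Ck 2 G"
  shows "path_deriv T (\<lambda>t. G (x t)) (\<lambda>t. frechet_derivative G (at (x t)) (v t))" (is ?d)
    and "lip_path T (\<lambda>t. frechet_derivative G (at (x t)) (v t))" (is ?l)
proof -
  note G = assms[unfolded numeral_2_eq_2]
  show ?d by (rule path_deriv_comp[OF Ck_derivative[OF G]])
  have eq: "frechet_derivative G (at y) u = (\<Sum>b\<in>Basis. (u \<bullet> b) *\<^sub>R frechet_derivative G (at y) b)" for y u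
  proof -
    interpret bounded_linear "frechet_derivative G (at y)"
      by (rule has_derivative_bounded_linear[OF Ck_derivative[OF G]])
    show ?thesis
      by (subst euclidean_representation[symmetric, of u]) (simp add: sum scaleR)
  qed
  have "Ck (Suc 0) (\<lambda>y. frechet_derivative G (at y) b)" for b using G by simp
  note lip = lip_path_comp[OF ulip_Ck[OF this], unfolded lip_path_def]
  have "lip_path T (\<lambda>t. \<Sum>b\<in>Basis. (v t \<bullet> b) *\<^sub>R frechet_derivative G (at (x t)) b)"
    unfolding lip_path_def
    by (intro ulip_sum finite_Basis ulip_scaleR ulip_inner ulip_const lip
        lip_path_v[unfolded lip_path_def])
  then show ?l by (simp only: eq[symmetric])
qed

definition mag :: "real \<Rightarrow> real^3" where "mag t = cross3 (v t) (B (x t))"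

definition mag' :: "real \<Rightarrow> real^3" where
  "mag' t = cross3 (v t) (frechet_derivative B (at (x t)) (v t)) + cross3 (mag t + E (x t)) (B (x t))"

lemma lip_path_mag: "lip_path T mag"
  using lip_path_v lip_path_comp[OF ulip_B] unfolding lip_path_def mag_def
  by (rule ulip_bilinear[OF bounded_bilinear_cross3])

lemma lip_path_acc: "lip_path T (\<lambda>t. mag t + E (x t))"
  using lip_path_mag lip_path_comp[OF ulip_E] unfolding lip_path_def by (rule ulip_add)

lemma v_deriv_mag: "path_deriv T v (\<lambda>t. mag t + E (x t))"
  using v_deriv by (simp add: mag_def)

lemma mag_deriv: "path_deriv T mag mag'"
  using v_deriv_mag path_C2(1)[OF B_smooth] unfolding path_deriv_def mag_def[abs_def] mag'_def
  by (auto intro!: bounded_bilinear.has_vector_derivative[OF bounded_bilinear_cross3])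

lemma lip_path_mag': "lip_path T mag'"
  using lip_path_v lip_path_comp[OF ulip_B] lip_path_comp[OF ulip_E] lip_path_mag path_C2(2)[OF B_smooth]
  unfolding lip_path_def mag'_def
  by (intro ulip_add ulip_bilinear[OF bounded_bilinear_cross3]) auto

text \<open>Minus the power delivered by the electric field, that is, the rate of change of
  \<open>U\<close> along the trajectory, because \<open>E\<close> is the negative gradient.\<close>

definition elec_power :: "real \<Rightarrow> real" where "elec_power t = - (v t \<bullet> E (x t))"

definition elec_power' :: "real \<Rightarrow> real" where
  "elec_power' t = - (v t \<bullet> frechet_derivative E (at (x t)) (v t) + (mag t + E (x t)) \<bullet> E (x t))"

lemma U_path_deriv: "path_deriv T (\<lambda>t. U (x t)) elec_power"
  using path_deriv_comp[OF U_derivative] by (simp add: elec_power_def[abs_def])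

lemma power_deriv: "path_deriv T elec_power elec_power'"
  unfolding path_deriv_def elec_power_def[abs_def] elec_power'_def
proof
  fix t assume "t \<in> {0..T}"
  then have "(v has_vector_derivative mag t + E (x t)) (at t within {0..T})"
    "((\<lambda>t. E (x t)) has_vector_derivative frechet_derivative E (at (x t)) (v t)) (at t within {0..T})"
    using v_deriv_mag path_C2(1)[OF E_smooth] unfolding path_deriv_def by blast+
  then show "((\<lambda>t. - (v t \<bullet> E (x t))) has_vector_derivative
      - (v t \<bullet> frechet_derivative E (at (x t)) (v t) + (mag t + E (x t)) \<bullet> E (x t))) (at t within {0..T})"
    by (rule has_vector_derivative_minus[OF
        bounded_bilinear.has_vector_derivative[OF bounded_bilinear_inner]])
qed

lemma lip_path_power: "lip_path T elec_power"
  using lip_path_v lip_path_comp[OF ulip_E] unfolding lip_path_def elec_power_def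
  by (intro ulip_minus ulip_inner)

lemma lip_path_power': "lip_path T elec_power'"
  using lip_path_v lip_path_comp[OF ulip_E] lip_path_mag path_C2(2)[OF E_smooth]
  unfolding lip_path_def elec_power'_def
  by (intro ulip_minus ulip_add ulip_inner) auto

section \<open>Local errors of both schemes along the exact trajectory\<close>

lemma v_quadrature:
  "bigO T 3 (\<lambda>h t. v (t + h) - v t - (h / 2) *\<^sub>R (mag t + mag (t + h)) - h *\<^sub>R E (x (t + h / 2)))"
  by (rule bigO_quadrature[OF v_deriv_mag mag_deriv lip_path_mag' path_C2[OF E_smooth]])

text \<open>Since \<open>w\<close> is \<open>v\<close> up to \<open>O(h)\<close>, the predicted
  position is \<open>x (t + h / 2)\<close> up to \<open>O(h^2)\<close>. In the scalar factor the
  first-order terms cancel: \<open>U (x t) - U (xh h t)\<close> is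
  \<open>(h / 2) * (v t \<bullet> E (x t))\<close> to first order, and the predictor of
  \<open>r\<close> subtracts just this amount.\<close>

lemma F_step_approx:
  assumes w: "bigO T 1 (\<lambda>h t. w h t - v t)"
  shows "bigO T 2 (\<lambda>h t. F_step U E h (x t) (w h t) (exp (U (x t))) - E (x (t + h / 2)))"
proof -
  note v0 = bigO_0_path[OF lip_path_v] and x0 = bigO_0_path[OF lip_path_x]
    and xm0 = bigO_0_pathm[OF lip_path_x] and E0 = bigO_0_path[OF lip_path_comp[OF ulip_E]]
    and Em0 = bigO_0_pathm[OF lip_path_comp[OF ulip_E]]
  define xh where "xh h t = x t + (h / 2) *\<^sub>R w h t" for h t
  have "bigO T 2 (\<lambda>h t. x (t + h / 2) - x t - (h / 2) *\<^sub>R v t)"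
    using bigO_taylor1[OF x_deriv lip_path_v, of "1/2"] by simp
  from bigO_diff[OF bigO_scaleR_h[OF w, of 2 "1/2"] this]
  have xh: "bigO T 2 (\<lambda>h t. xh h t - x (t + h / 2))"
    by (simp add: xh_def algebra_simps)
  have Eh: "bigO T 2 (\<lambda>h t. E (xh h t) - E (x (t + h / 2)))"
    by (rule bigO_ulip_diff[OF ulip_E xh xm0])
  have Uh: "bigO T 2 (\<lambda>h t. U (xh h t) - U (x (t + h / 2)))"
    by (rule bigO_ulip_diff[OF ulip_U xh xm0])
  have Um: "bigO T 2 (\<lambda>h t. U (x (t + h / 2)) - U (x t) - (h / 2) * elec_power t)"
    using bigO_taylor1[OF U_path_deriv lip_path_power, of "1/2"] by simp
  have "bigO T 1 (\<lambda>h t. E (x (t + h / 2)) - E (x t))"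
    using bigO_path_diff[OF lip_path_comp[OF ulip_E], of "1/2"] by simp
  then have "bigO T 1 (\<lambda>h t. E (xh h t) - E (x t))"
    using bigO_trans[OF bigO_mono[OF Eh, of 1]] by simp
  from bigO_scaleR_h[OF bigO_bilinear_diff[OF bounded_bilinear_inner w v0 this E0], of 2 "1/2"]
  have wE: "bigO T 2 (\<lambda>h t. (h / 2) * (w h t \<bullet> E (xh h t) - v t \<bullet> E (x t)))"
    by simp
  have \<theta>: "bigO T 2 (\<lambda>h t. U (x t) - U (xh h t) - h / 2 * (w h t \<bullet> E (xh h t)))"
    by (rule bigO_cong[OF bigO_minus[OF bigO_add[OF bigO_add[OF Uh Um] wE]]])
      (simp add: elec_power_def algebra_simps)
  have "bigO T 1 (\<lambda>h t. U (x (t + h / 2)) - U (x t))"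
    using bigO_path_diff[OF lip_path_comp[OF ulip_U], of "1/2"] by simp
  then have "bigO T 1 (\<lambda>h t. U (xh h t) - U (x t))"
    using bigO_trans[OF bigO_mono[OF Uh, of 1]] by simp
  \<comment> \<open>Adding \<open>exp d - 1 - d\<close> for \<open>d = U (x t) - U (xh h t)\<close>
    to the cancelled terms gives the scalar factor minus 1.\<close>
  from bigO_add[OF bigO_exp[OF bigO_sym[OF this]] \<theta>]
  have "bigO T 2 (\<lambda>h t. exp (U (x t) - U (xh h t)) - h / 2 * (w h t \<bullet> E (xh h t)) - 1)"
    by (rule bigO_cong) simp
  from bigO_bilinear_diff[OF bounded_bilinear_scaleR this bigO_const Eh Em0]
  show ?thesis by (simp add: F_step_exp xh_def)
qed

text \<open>A chain of midpoint replacements: the change of \<open>U\<close> is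
  \<open>- h * (v \<bullet> E)\<close> at the midpoint, \<open>h *\<^sub>R v\<close> there is the
  exact displacement, and \<open>E\<close> there is \<open>F\<close>, each up to
  \<open>O(h^3)\<close>. Passing to the numerical displacement costs the position error of order
  \<open>k\<close>.\<close>

lemma log_energy_approx:
  assumes X: "bigO T k (\<lambda>h t. X h t - x (t + h))" and F: "bigO T 2 (\<lambda>h t. F h t - E (x (t + h / 2)))"
    and k: "k \<le> 3"
  shows "bigO T k (\<lambda>h t. U (x t) - (X h t - x t) \<bullet> F h t - U (x (t + h)))"
proof -
  note Em0 = bigO_0_pathm[OF lip_path_comp[OF ulip_E]]
  have F0: "bigO T 0 F" using F Em0 by (rule bigO_0I)
  have 1: "bigO T 3 (\<lambda>h t. U (x (t + h)) - U (x t) - h * elec_power (t + h / 2))"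
    using bigO_midpoint[OF U_path_deriv power_deriv lip_path_power'] by simp
  have 2: "bigO T 3 (\<lambda>h t. (x (t + h) - x t - h *\<^sub>R v (t + h / 2)) \<bullet> E (x (t + h / 2)))"
    using bigO_bilinear[OF bounded_bilinear_inner bigO_midpoint[OF x_deriv v_deriv_mag lip_path_acc] Em0] by simp
  have "bigO T 1 (\<lambda>h t. x (t + h) - x t)"
    using bigO_path_diff[OF lip_path_x, of 1] by simp
  from bigO_bilinear[OF bounded_bilinear_inner this F]
  have 3: "bigO T 3 (\<lambda>h t. (x (t + h) - x t) \<bullet> (F h t - E (x (t + h / 2))))"
    by (simp add: numeral_3_eq_3)
  have 4: "bigO T k (\<lambda>h t. (X h t - x (t + h)) \<bullet> F h t)"
    using bigO_bilinear[OF bounded_bilinear_inner X F0] by simp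
  show ?thesis
    by (rule bigO_cong[OF bigO_minus[OF bigO_add[OF bigO_mono[OF bigO_add[OF bigO_add[OF 1 2] 3] k] 4]]])
      (simp add: elec_power_def algebra_simps)
qed

abbreviation sol :: "real \<Rightarrow> state" where "sol t \<equiv> (x t, v t, U (x t))"

text \<open>The third component follows from the errors of position and kick, so each scheme only
  has to supply \<open>X\<close>, \<open>V\<close> and \<open>F\<close>.\<close>

lemma log_step_consistent:
  fixes a b defines "A \<equiv> \<lambda>t. a *\<^sub>R B_tilde B (x t)"
  defines "w \<equiv> \<lambda>h t. mat_exp (h *\<^sub>R A t) *v v t"
  defines "F \<equiv> \<lambda>h t. F_step U E h (x t) (w h t) (exp (U (x t)))"
  defines "X \<equiv> \<lambda>h t. x t + h *\<^sub>R w h t + (h\<^sup>2 / 2) *\<^sub>R F h t"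
  assumes X: "bigO T k (\<lambda>h t. X h t - x (t + h))"
    and V: "bigO T k (\<lambda>h t. mat_exp (h *\<^sub>R (b *\<^sub>R B_tilde B (X h t))) *v (w h t + h *\<^sub>R F h t) - v (t + h))"
    and F: "bigO T 2 (\<lambda>h t. F h t - E (x (t + h / 2)))" and k: "k \<le> 3"
  shows "bigO T k (\<lambda>h t. log_step a b U E B h (sol t) - sol (t + h))"
  using bigO_Pair[OF X bigO_Pair[OF V log_energy_approx[OF X F k]]]
  by (simp add: log_step_def Let_def X_def F_def w_def A_def)

lemma lip_path_rotation: "lip_path T (\<lambda>t. a *\<^sub>R B_tilde B (x t))"
  using lip_path_comp[OF ulip_B_tilde] unfolding lip_path_def
  by (intro ulip_scaleR ulip_const)

lemma rotation_v: "(a *\<^sub>R B_tilde B (x t)) *v v t = a *\<^sub>R mag t"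
  by (simp add: scaleR_matrix_vector_assoc[symmetric] B_tilde_mult mag_def)

text \<open>The full rotation gives \<open>w = v + h * mag + O(h^2)\<close>, and
  \<open>F = E (x t) + O(h)\<close>, so the new velocity matches the first-order Taylor polynomial;
  in the position, \<open>w = v + O(h)\<close> gives the same order because of its factor
  \<open>h\<close>.\<close>

lemma S1_consistent: "bigO T 2 (\<lambda>h t. log_step 1 0 U E B h (sol t) - sol (t + h))"
proof -
  define w where "w h t = mat_exp (h *\<^sub>R (1 *\<^sub>R B_tilde B (x t))) *v v t" for h t
  define F where "F h t = F_step U E h (x t) (w h t) (exp (U (x t)))" for h t
  note A0 = bigO_0_path[OF lip_path_rotation[of 1]] and v0 = bigO_0_path[OF lip_path_v]
  have w1: "bigO T 1 (\<lambda>h t. w h t - v t)"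
    unfolding w_def by (rule bigO_mat_exp1[OF A0 v0])
  have w2: "bigO T 2 (\<lambda>h t. w h t - v t - h *\<^sub>R mag t)"
    using bigO_mat_exp2[OF A0 v0] unfolding rotation_v w_def by simp
  have F: "bigO T 2 (\<lambda>h t. F h t - E (x (t + h / 2)))"
    unfolding F_def by (rule F_step_approx[OF w1])
  have F0: "bigO T 0 F" using F bigO_0_pathm[OF lip_path_comp[OF ulip_E]] by (rule bigO_0I)
  have "bigO T 1 (\<lambda>h t. E (x (t + h / 2)) - E (x t))"
    using bigO_path_diff[OF lip_path_comp[OF ulip_E], of "1/2"] by simp
  then have FE: "bigO T 1 (\<lambda>h t. F h t - E (x t))"
    using bigO_trans[OF bigO_mono[OF F, of 1]] by simp
  have x1: "bigO T 2 (\<lambda>h t. x (t + h) - x t - h *\<^sub>R v t)"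
    using bigO_taylor1[OF x_deriv lip_path_v, of 1] by simp
  have v1: "bigO T 2 (\<lambda>h t. v (t + h) - v t - h *\<^sub>R (mag t + E (x t)))"
    using bigO_taylor1[OF v_deriv_mag lip_path_acc, of 1] by simp
  have X: "bigO T 2 (\<lambda>h t. x t + h *\<^sub>R w h t + (h\<^sup>2 / 2) *\<^sub>R F h t - x (t + h))"
  proof (rule bigO_cong[OF bigO_add[OF bigO_diff[OF _ x1]]])
    show "bigO T 2 (\<lambda>h t. (1 * h) *\<^sub>R (w h t - v t))" by (rule bigO_scaleR_h[OF w1]) simp
    show "bigO T 2 (\<lambda>h t. ((1/2) * h\<^sup>2) *\<^sub>R F h t)" by (rule bigO_scaleR_h2[OF F0]) simp
  qed (simp add: algebra_simps)
  have V: "bigO T 2 (\<lambda>h t. w h t + h *\<^sub>R F h t - v (t + h))"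
  proof (rule bigO_cong[OF bigO_add[OF bigO_diff[OF w2 v1]]])
    show "bigO T 2 (\<lambda>h t. (1 * h) *\<^sub>R (F h t - E (x t)))" by (rule bigO_scaleR_h[OF FE]) simp
  qed (simp add: algebra_simps)
  show ?thesis
    by (rule log_step_consistent) (use X V F in \<open>simp_all add: w_def F_def mat_exp_zero\<close>)
qed

text \<open>Position: the half rotation adds \<open>(h / 2) *\<^sub>R mag t\<close> to
  \<open>w\<close>, so \<open>h *\<^sub>R w\<close> supplies the magnetic part of the second-order
  Taylor term. Velocity: the argument of the final rotation is compared with the exact end velocity
  rotated backwards.\<close>

lemma S2_consistent: "bigO T 3 (\<lambda>h t. log_step (1/2) (1/2) U E B h (sol t) - sol (t + h))"
proof -
  define K where "K t = (1/2) *\<^sub>R B_tilde B (x t)" for t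
  define w where "w h t = mat_exp (h *\<^sub>R K t) *v v t" for h t
  define F where "F h t = F_step U E h (x t) (w h t) (exp (U (x t)))" for h t
  define X where "X h t = x t + h *\<^sub>R w h t + (h\<^sup>2 / 2) *\<^sub>R F h t" for h t
  define g where "g t = K t *v (K t *v v t)" for t
  have K_lip: "lip_path T K" unfolding K_def by (rule lip_path_rotation)
  have g_lip: "lip_path T g"
    using K_lip lip_path_v unfolding g_def lip_path_def by (intro ulip_matrix_vector)
  have Kv: "K t *v v t = (1/2) *\<^sub>R mag t" for t unfolding K_def by (rule rotation_v)
  note K0 = bigO_0_path[OF K_lip] and K10 = bigO_0_path1[OF K_lip] and v0 = bigO_0_path[OF lip_path_v]
  have w1: "bigO T 1 (\<lambda>h t. w h t - v t)"
    unfolding w_def by (rule bigO_mat_exp1[OF K0 v0])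
  have w2: "bigO T 2 (\<lambda>h t. w h t - v t - h *\<^sub>R (K t *v v t))"
    unfolding w_def by (rule bigO_mat_exp2[OF K0 v0])
  have w3: "bigO T 3 (\<lambda>h t. w h t - v t - h *\<^sub>R (K t *v v t) - (h\<^sup>2 / 2) *\<^sub>R g t)"
    unfolding w_def g_def by (rule bigO_mat_exp3[OF K0 v0])
  have F: "bigO T 2 (\<lambda>h t. F h t - E (x (t + h / 2)))"
    unfolding F_def by (rule F_step_approx[OF w1])
  have "bigO T 1 (\<lambda>h t. E (x (t + h / 2)) - E (x t))"
    using bigO_path_diff[OF lip_path_comp[OF ulip_E], of "1/2"] by simp
  then have FE: "bigO T 1 (\<lambda>h t. F h t - E (x t))"
    using bigO_trans[OF bigO_mono[OF F, of 1]] by simp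
  have x1: "bigO T 3 (\<lambda>h t. x (t + h) - x t - h *\<^sub>R v t - (h\<^sup>2 / 2) *\<^sub>R (mag t + E (x t)))"
    using bigO_taylor2[OF x_deriv v_deriv_mag lip_path_acc, of 1] by simp
  have hw: "bigO T 3 (\<lambda>h t. (1 * h) *\<^sub>R (w h t - v t - h *\<^sub>R (K t *v v t)))"
    by (rule bigO_scaleR_h[OF w2]) simp
  have hF: "bigO T 3 (\<lambda>h t. ((1/2) * h\<^sup>2) *\<^sub>R (F h t - E (x t)))"
    by (rule bigO_scaleR_h2[OF FE]) simp
  have X: "bigO T 3 (\<lambda>h t. X h t - x (t + h))"
    by (rule bigO_cong[OF bigO_add[OF bigO_diff[OF hw x1] hF]])
      (simp add: X_def Kv algebra_simps power2_eq_square)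
  \<comment> \<open>Second-order expansion of the backward half rotation applied to
    \<open>v (t + h)\<close>, with the field taken at the exact end position.\<close>
  define z where "z h t = v (t + h) - h *\<^sub>R (K (t + h) *v v (t + h)) + (h\<^sup>2 / 2) *\<^sub>R g (t + h)" for h t
  have hF': "bigO T 3 (\<lambda>h t. (1 * h) *\<^sub>R (F h t - E (x (t + h / 2))))"
    by (rule bigO_scaleR_h[OF F]) simp
  have "bigO T 1 (\<lambda>h t. g (t + h) - g t)"
    using bigO_path_diff[OF g_lip, of 1] by simp
  then have hg: "bigO T 3 (\<lambda>h t. ((1/2) * h\<^sup>2) *\<^sub>R (g (t + h) - g t))"
    by (rule bigO_scaleR_h2) simp
  \<comment> \<open>The linear rotation terms at \<open>t\<close> and \<open>t + h\<close> form the
    trapezoidal sum of \<open>mag\<close>, the kick is the midpoint value of \<open>E\<close>, and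
    the quadratic terms \<open>g\<close> at the two times differ by \<open>O(h)\<close>.\<close>
  have q: "bigO T 3 (\<lambda>h t. (w h t + h *\<^sub>R F h t) - z h t)"
  proof (rule bigO_cong[OF bigO_diff[OF bigO_add[OF bigO_diff[OF w3 v_quadrature] hF'] hg]])
    fix h t
    have "h *\<^sub>R (K s *v v s) = (h / 2) *\<^sub>R mag s" for s by (simp add: Kv)
    then show "w h t - v t - h *\<^sub>R (K t *v v t) - (h\<^sup>2 / 2) *\<^sub>R g t
        - (v (t + h) - v t - (h / 2) *\<^sub>R (mag t + mag (t + h)) - h *\<^sub>R E (x (t + h / 2)))
        + (1 * h) *\<^sub>R (F h t - E (x (t + h / 2))) - ((1/2) * h\<^sup>2) *\<^sub>R (g (t + h) - g t)
        = w h t + h *\<^sub>R F h t - z h t"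
      by (simp add: z_def algebra_simps)
  qed
  note v10 = bigO_0_path1[OF lip_path_v]
  note Kmul = bigO_bilinear[OF bounded_bilinear_matrix_vector_mult K10, of 0, simplified]
  have z0: "bigO T 0 z"
    unfolding z_def
    using bigO_scaleR_h[OF Kmul[OF v10], of 0 1] bigO_scaleR_h2[OF bigO_0_path1[OF g_lip], of 0 "1/2"]
    by (intro bigO_add bigO_diff v10) simp_all
  \<comment> \<open>The scheme takes the second rotation at the numerical end position; replacing it
    by the exact one costs only the position error.\<close>
  have "bigO T 3 (\<lambda>h t. (1/2) *\<^sub>R B_tilde B (X h t) - K (t + h))"
    using bigO_scaleR[OF bigO_ulip_diff[OF ulip_B_tilde X bigO_0_path1[OF lip_path_x]], of "1/2"]
    by (simp add: K_def scaleR_diff_right)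
  from bigO_ulip_diff[OF ulip_mat_exp this K10]
  have M: "bigO T 3 (\<lambda>h t. mat_exp (h *\<^sub>R ((1/2) *\<^sub>R B_tilde B (X h t))) - mat_exp (h *\<^sub>R K (t + h)))" .
  have M0: "bigO T 0 (\<lambda>h t. mat_exp (h *\<^sub>R K (t + h)))"
    by (rule bigO_ulip[OF ulip_mat_exp K10])
  have 1: "bigO T 3 (\<lambda>h t. mat_exp (h *\<^sub>R ((1/2) *\<^sub>R B_tilde B (X h t))) *v (w h t + h *\<^sub>R F h t)
      - mat_exp (h *\<^sub>R K (t + h)) *v z h t)"
    by (rule bigO_matrix_vector_diff[OF M M0 q z0])
  have 2: "bigO T 3 (\<lambda>h t. mat_exp (h *\<^sub>R K (t + h)) *v z h t - z h t - h *\<^sub>R (K (t + h) *v z h t)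
      - (h\<^sup>2 / 2) *\<^sub>R (K (t + h) *v (K (t + h) *v z h t)))"
    by (rule bigO_mat_exp3[OF K10 z0])
  \<comment> \<open>The product of the truncated forward and backward rotations is the identity plus
    \<open>(h^4 / 4) K^4\<close> with \<open>K\<close> taken at \<open>t + h\<close>. This leftover
    is split into two factors \<open>h\<^sup>2\<close> to fit \<open>bigO_scaleR_h2\<close>.\<close>
  have "bigO T 0 (\<lambda>h t. K (t + h) *v (K (t + h) *v g (t + h)))"
    by (rule Kmul[OF Kmul[OF bigO_0_path1[OF g_lip]]])
  then have "bigO T 1 (\<lambda>h t. (1 * h\<^sup>2) *\<^sub>R (K (t + h) *v (K (t + h) *v g (t + h))))"
    by (rule bigO_scaleR_h2) simp
  then have 3: "bigO T 3 (\<lambda>h t. ((1/4) * h\<^sup>2) *\<^sub>R (1 * h\<^sup>2) *\<^sub>R (K (t + h) *v (K (t + h) *v g (t + h))))"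
    by (rule bigO_scaleR_h2) simp
  have V: "bigO T 3 (\<lambda>h t. mat_exp (h *\<^sub>R ((1/2) *\<^sub>R B_tilde B (X h t))) *v (w h t + h *\<^sub>R F h t) - v (t + h))"
  proof (rule bigO_cong[OF bigO_add[OF bigO_add[OF 1 2] 3]])
    fix h t
    define L where "L = K (t + h)"
    define u where "u = v (t + h)"
    have g: "g (t + h) = L *v (L *v u)" by (simp add: g_def L_def u_def)
    have z: "z h t = u - h *\<^sub>R (L *v u) + (h\<^sup>2 / 2) *\<^sub>R (L *v (L *v u))"
      by (simp add: z_def g_def L_def u_def)
    have "z h t + h *\<^sub>R (L *v z h t) + (h\<^sup>2 / 2) *\<^sub>R (L *v (L *v z h t))
        = u + ((1/4) * h\<^sup>2) *\<^sub>R (1 * h\<^sup>2) *\<^sub>R (L *v (L *v (L *v (L *v u))))"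
      unfolding z matrix_vector_right_distrib matrix_vector_mult_diff_distrib matrix_vector_mult_scaleR
      by (simp add: vec_eq_iff field_simps power2_eq_square)
    then show "mat_exp (h *\<^sub>R ((1/2) *\<^sub>R B_tilde B (X h t))) *v (w h t + h *\<^sub>R F h t)
        - mat_exp (h *\<^sub>R K (t + h)) *v z h t
      + (mat_exp (h *\<^sub>R K (t + h)) *v z h t - z h t - h *\<^sub>R (K (t + h) *v z h t)
        - (h\<^sup>2 / 2) *\<^sub>R (K (t + h) *v (K (t + h) *v z h t)))
      + ((1/4) * h\<^sup>2) *\<^sub>R (1 * h\<^sup>2) *\<^sub>R (K (t + h) *v (K (t + h) *v g (t + h)))
      = mat_exp (h *\<^sub>R ((1/2) *\<^sub>R B_tilde B (X h t))) *v (w h t + h *\<^sub>R F h t) - v (t + h)"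
      unfolding g L_def[symmetric] u_def[symmetric] by (simp add: algebra_simps)
  qed
  show ?thesis
    by (rule log_step_consistent) (use X V F in \<open>simp_all add: X_def F_def w_def K_def\<close>)
qed

section \<open>From local errors to global convergence of both schemes\<close>

lemma convergence:
  assumes S: "\<And>h z. S h (of_log z) = of_log (log_step a b U E B h z)"
    and err: "bigO T (Suc p) (\<lambda>h t. log_step a b U E B h (sol t) - sol (t + h))" and p: "p > 0"
  shows "\<exists>\<alpha> C. 0 < \<alpha> \<and> \<alpha> \<le> 1 \<and> (\<forall>h n. 0 < h \<and> h \<le> \<alpha> \<and> real n * h \<le> T \<longrightarrow>
     norm (pos ((S h ^^ n) (of_log (sol 0))) - x (real n * h)) \<le> C * h ^ p \<and>
     norm (vel ((S h ^^ n) (of_log (sol 0))) - v (real n * h)) \<le> C * h ^ p)"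
proof -
  obtain \<phi> where \<phi>: "\<And>R. ulip {0<..1} (cball 0 R) \<phi>"
    "\<And>h z. 0 < h \<Longrightarrow> h \<le> 1 \<Longrightarrow> log_step a b U E B h z = z + h *\<^sub>R \<phi> h z"
    using log_step_increment by blast
  have "lip_path T sol"
    using lip_path_x lip_path_v lip_path_comp[OF ulip_U] unfolding lip_path_def by (intro ulip_Pair)
  then obtain L where "\<And>t. t \<in> {0..T} \<Longrightarrow> norm (sol t) \<le> L" by (rule lip_pathE) blast
  then have "bounded (sol ` {0..T})" by (intro boundedI[where B = L]) auto
  from one_step_convergence[OF \<phi>(2,1) err this T_pos p]
  obtain \<alpha> C where \<alpha>: "0 < \<alpha>" "\<alpha> \<le> 1" and le: "\<And>h n. 0 < h \<Longrightarrow> h \<le> \<alpha> \<Longrightarrow> real n * h \<le> T \<Longrightarrow>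
      norm ((log_step a b U E B h ^^ n) (sol 0) - sol (real n * h)) \<le> C * h ^ p"
    by auto
  have "norm (pos ((S h ^^ n) (of_log (sol 0))) - x (real n * h)) \<le> C * h ^ p \<and>
     norm (vel ((S h ^^ n) (of_log (sol 0))) - v (real n * h)) \<le> C * h ^ p"
    if "0 < h" "h \<le> \<alpha>" "real n * h \<le> T" for h n
  proof -
    let ?d = "(log_step a b U E B h ^^ n) (sol 0) - sol (real n * h)"
    \<comment> \<open>Position and velocity are components of the state, untouched by
      \<open>of_log\<close>, so the error in the product norm bounds both.\<close>
    have "norm (fst p) \<le> norm p" for p :: "'c::real_normed_vector \<times> 'd::real_normed_vector"
      using norm_fst_le[of "fst p" "snd p"] by (simp only: prod.collapse)
    moreover have "norm (snd ?d) \<le> norm ?d"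
      using norm_snd_le[of "snd ?d" "fst ?d"] by (simp only: prod.collapse)
    ultimately have "norm (fst ?d) \<le> norm ?d" "norm (fst (snd ?d)) \<le> norm ?d"
      using order_trans by blast+
    then show ?thesis
      using le[OF that] by (simp add: funpow_of_log[of "S h", OF S])
  qed
  with \<alpha> show ?thesis by blast
qed

end

theorem theorem2p3:
  fixes U :: "real^3 \<Rightarrow> real"
    and E B :: "real^3 \<Rightarrow> real^3"
    and x0 v0 :: "real^3"
    and T :: real
    and x v :: "real \<Rightarrow> real^3"
  assumes E_grad: "\<And>z. GDERIV U z :> - E z"
    and E_smooth: "Ck 2 E"
    and B_smooth: "Ck 2 B"
    and T_pos: "T > 0"
    and sol: "cpd_solution E B x0 v0 T x v"
  shows "\<exists>\<alpha>. 0 < \<alpha> \<and> \<alpha> \<le> 1 \<and>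
    (\<exists>C. \<forall>h N n. 0 < h \<and> h \<le> \<alpha> \<and> T / h = real N \<and> n < N \<longrightarrow>
        norm (pos (S1_num U E B x0 v0 h (Suc n)) - x (real (Suc n) * h)) \<le> C * h \<and>
        norm (vel (S1_num U E B x0 v0 h (Suc n)) - v (real (Suc n) * h)) \<le> C * h) \<and>
    (\<exists>C. \<forall>h N n. 0 < h \<and> h \<le> \<alpha> \<and> T / h = real N \<and> n < N \<longrightarrow>
        norm (pos (S2_num U E B x0 v0 h (Suc n)) - x (real (Suc n) * h)) \<le> C * h\<^sup>2 \<and>
        norm (vel (S2_num U E B x0 v0 h (Suc n)) - v (real (Suc n) * h)) \<le> C * h\<^sup>2)"
proof -
  interpret cpd U E B T x v
    using assms by unfold_locales (auto simp: cpd_solution_def path_deriv_def)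
  have init: "of_log (x 0, v 0, U (x 0)) = (x0, v0, exp (U x0))"
    using sol by (simp add: cpd_solution_def of_log_def)
  \<comment> \<open>Local order \<open>Suc p\<close> yields global order \<open>p\<close>: here
    \<open>p = 1\<close>, and \<open>p = 2\<close> for the second scheme.\<close>
  obtain \<alpha>1 C1 where 1: "0 < \<alpha>1" "\<alpha>1 \<le> 1" "\<And>h n. 0 < h \<Longrightarrow> h \<le> \<alpha>1 \<Longrightarrow> real n * h \<le> T \<Longrightarrow>
     norm (pos (S1_num U E B x0 v0 h n) - x (real n * h)) \<le> C1 * h ^ 1 \<and>
     norm (vel (S1_num U E B x0 v0 h n) - v (real n * h)) \<le> C1 * h ^ 1"
    using convergence[where S = "S1_step U E B" and p = 1, OF S1_step_of_log] S1_consistent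
    unfolding init S1_num_def[symmetric] by (auto simp: numeral_2_eq_2)
  obtain \<alpha>2 C2 where 2: "0 < \<alpha>2" "\<alpha>2 \<le> 1" "\<And>h n. 0 < h \<Longrightarrow> h \<le> \<alpha>2 \<Longrightarrow> real n * h \<le> T \<Longrightarrow>
     norm (pos (S2_num U E B x0 v0 h n) - x (real n * h)) \<le> C2 * h ^ 2 \<and>
     norm (vel (S2_num U E B x0 v0 h n) - v (real n * h)) \<le> C2 * h ^ 2"
    using convergence[where S = "S2_step U E B" and p = 2, OF S2_step_of_log] S2_consistent
    unfolding init S2_num_def[symmetric] by (auto simp: numeral_3_eq_3 numeral_2_eq_2)
  \<comment> \<open>\<open>n < N\<close> admits the index \<open>Suc n\<close>, the last grid point
    being \<open>T\<close> itself.\<close>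
  have grid: "real (Suc n) * h \<le> T" if "0 < h" "T / h = real N" "n < N" for h n N
  proof -
    have "real (Suc n) * h \<le> real N * h" using that by (intro mult_right_mono) auto
    also have "real N * h = T" using that(1) by (simp flip: that(2))
    finally show ?thesis .
  qed
  \<comment> \<open>The minimum of the two thresholds serves both schemes, while each keeps its own
    constant.\<close>
  have "\<forall>h N n. 0 < h \<and> h \<le> min \<alpha>1 \<alpha>2 \<and> T / h = real N \<and> n < N \<longrightarrow>
      norm (pos (S1_num U E B x0 v0 h (Suc n)) - x (real (Suc n) * h)) \<le> C1 * h \<and>
      norm (vel (S1_num U E B x0 v0 h (Suc n)) - v (real (Suc n) * h)) \<le> C1 * h" (is "\<forall>h N n. ?H h N n \<longrightarrow> ?G1 h n")
  proof (intro allI impI)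
    show "?G1 h n" if "?H h N n" for h N n
      using 1(3)[of h "Suc n"] grid[of h N n] that by (simp del: of_nat_Suc)
  qed
  moreover have "\<forall>h N n. ?H h N n \<longrightarrow>
      norm (pos (S2_num U E B x0 v0 h (Suc n)) - x (real (Suc n) * h)) \<le> C2 * h\<^sup>2 \<and>
      norm (vel (S2_num U E B x0 v0 h (Suc n)) - v (real (Suc n) * h)) \<le> C2 * h\<^sup>2" (is "\<forall>h N n. _ \<longrightarrow> ?G2 h n")
  proof (intro allI impI)
    show "?G2 h n" if "?H h N n" for h N n
      using 2(3)[of h "Suc n"] grid[of h N n] that by (simp del: of_nat_Suc)
  qed
  moreover have "0 < min \<alpha>1 \<alpha>2" "min \<alpha>1 \<alpha>2 \<le> 1" using 1 2 by auto
  ultimately show ?thesis by blast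
qed

end
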